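(* Let $\Omega\subset\mathbb{R}^n$ be an open set. Assume that $B\in C^1(\Omega\times\mathbb{R}\times\mathbb{R}^n;\mathbb{R}^n)$, $c\in C(\Omega\times\mathbb{R}\times\mathbb{R}^n)$ and $f,g\in C(\Omega)$. Suppose that $u\in W^{1,\infty}_{\rm loc}(\Omega)$ is a viscosity subsolution of $$B(x,u,Du)\cdot D^2u\cdot B(x,u,Du)+c(x,u,Du)=f(x)\quad\text{in }\Omega,$$ and a viscosity supersolution of $$B(x,u,Du)\cdot D^2u\cdot B(x,u,Du)+c(x,u,Du)=g(x)\quad\text{in }\Omega.$$ Then $f\le g$ in $\Omega$.
   Context: For $p\in\mathbb{R}^n$ and an $n\times n$ matrix $A$, $p\cdot A\cdot p$ means $p\cdot(Ap)$. Functions in $W^{1,\infty}_{\rm loc}$ are identified with their continuous representatives. Viscosity sense for an equation $B(x,u,Du)\cdot D^2u\cdot B(x,u,Du)+c(x,u,Du)=h(x)$ with $h$ continuous: a continuous $u$ is a viscosity subsolution in $\Omega$ if whenever $\phi\in C^2(\Omega)$, $x_0\in\Omega$ and $u-\phi$ has a local maximum at $x_0$, then $B(x_0,u(x_0),D\phi(x_0))\cdot D^2\phi(x_0)\cdot B(x_0,u(x_0),D\phi(x_0))+c(x_0,u(x_0),D\phi(x_0))\ge h(x_0)$; it is a viscosity supersolution if whenever $u-\phi$ has a local minimum at $x_0$, the same expression is $\le h(x_0)$; a viscosity solution is both. *)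

theory Defs
  imports "HOL-Analysis.Analysis"
begin

definition pderiv_i :: "(real^'n \<Rightarrow> real) \<Rightarrow> 'n \<Rightarrow> real^'n \<Rightarrow> real" where
  "pderiv_i f i x = frechet_derivative f (at x) (axis i 1)"

definition grad :: "(real^'n \<Rightarrow> real) \<Rightarrow> real^'n \<Rightarrow> real^'n" where
  "grad f x = (\<chi> i. pderiv_i f i x)"

definition hess_apply :: "(real^'n \<Rightarrow> real) \<Rightarrow> real^'n \<Rightarrow> real^'n \<Rightarrow> real^'n" where
  "hess_apply f x p = frechet_derivative (grad f) (at x) p"

fun Ck_on :: "nat \<Rightarrow> (real^'n) set \<Rightarrow> (real^'n \<Rightarrow> real) \<Rightarrow> bool" where
  "Ck_on 0 U f = continuous_on U f"
| "Ck_on (Suc k) U f =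
     ((\<forall>x\<in>U. f differentiable (at x)) \<and> continuous_on U f \<and> (\<forall>i. Ck_on k U (pderiv_i f i)))"

definition smooth_on :: "(real^'n) set \<Rightarrow> (real^'n \<Rightarrow> real) \<Rightarrow> bool" where
  "smooth_on U f \<longleftrightarrow> (\<forall>k. Ck_on k U f)"

definition C1_on :: "'a::euclidean_space set \<Rightarrow> ('a \<Rightarrow> 'b::euclidean_space) \<Rightarrow> bool" where
  "C1_on S F \<longleftrightarrow> (\<exists>F' :: 'a \<Rightarrow> 'a \<Rightarrow>\<^sub>L 'b.
      (\<forall>z\<in>S. (F has_derivative blinfun_apply (F' z)) (at z)) \<and> continuous_on S F')"

definition test_fun :: "(real^'n) set \<Rightarrow> (real^'n \<Rightarrow> real) \<Rightarrow> bool" where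
  "test_fun \<Omega> \<phi> \<longleftrightarrow> smooth_on UNIV \<phi> \<and> compact (closure {x. \<phi> x \<noteq> 0})
      \<and> closure {x. \<phi> x \<noteq> 0} \<subseteq> \<Omega>"

text \<open>W^{1,\<infinity>}_loc(\<Omega>) (continuous representative): u continuous on \<Omega> (hence in L^\<infinity>_loc),
  with weak gradient G that is measurable and locally essentially bounded.\<close>
definition W1inf_loc :: "(real^'n) set \<Rightarrow> (real^'n \<Rightarrow> real) \<Rightarrow> bool" where
  "W1inf_loc \<Omega> u \<longleftrightarrow> continuous_on \<Omega> u \<and>
    (\<exists>G :: real^'n \<Rightarrow> real^'n.
       (\<forall>i. (\<lambda>x. G x $ i) \<in> borel_measurable lebesgue) \<and>
       (\<forall>K. compact K \<and> K \<subseteq> \<Omega> \<longrightarrow>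
           (\<exists>M. AE x in lebesgue. x \<in> K \<longrightarrow> norm (G x) \<le> M)) \<and>
       (\<forall>\<phi> i. test_fun \<Omega> \<phi> \<longrightarrow>
           (LINT x:\<Omega>|lebesgue. u x * pderiv_i \<phi> i x) = - (LINT x:\<Omega>|lebesgue. G x $ i * \<phi> x)))"

definition local_max_at :: "(real^'n) set \<Rightarrow> (real^'n \<Rightarrow> real) \<Rightarrow> real^'n \<Rightarrow> bool" where
  "local_max_at \<Omega> w x0 \<longleftrightarrow> (\<exists>e>0. \<forall>y\<in>\<Omega> \<inter> ball x0 e. w y \<le> w x0)"

definition local_min_at :: "(real^'n) set \<Rightarrow> (real^'n \<Rightarrow> real) \<Rightarrow> real^'n \<Rightarrow> bool" where
  "local_min_at \<Omega> w x0 \<longleftrightarrow> (\<exists>e>0. \<forall>y\<in>\<Omega> \<inter> ball x0 e. w x0 \<le> w y)"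

definition visc_op ::
  "(real^'n \<Rightarrow> real \<Rightarrow> real^'n \<Rightarrow> real^'n) \<Rightarrow> (real^'n \<Rightarrow> real \<Rightarrow> real^'n \<Rightarrow> real)
   \<Rightarrow> (real^'n \<Rightarrow> real) \<Rightarrow> (real^'n \<Rightarrow> real) \<Rightarrow> real^'n \<Rightarrow> real" where
  "visc_op B c u \<phi> x0 =
     (let p = B x0 (u x0) (grad \<phi> x0) in p \<bullet> hess_apply \<phi> x0 p + c x0 (u x0) (grad \<phi> x0))"

definition visc_sub where
  "visc_sub \<Omega> B c h u \<longleftrightarrow> continuous_on \<Omega> u \<and>
     (\<forall>\<phi> x0. Ck_on 2 \<Omega> \<phi> \<and> x0 \<in> \<Omega> \<and> local_max_at \<Omega> (\<lambda>x. u x - \<phi> x) x0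
        \<longrightarrow> visc_op B c u \<phi> x0 \<ge> h x0)"

definition visc_super where
  "visc_super \<Omega> B c h u \<longleftrightarrow> continuous_on \<Omega> u \<and>
     (\<forall>\<phi> x0. Ck_on 2 \<Omega> \<phi> \<and> x0 \<in> \<Omega> \<and> local_min_at \<Omega> (\<lambda>x. u x - \<phi> x) x0
        \<longrightarrow> visc_op B c u \<phi> x0 \<le> h x0)"

end

theory Submission
  imports Defs
begin

text \<open>
  Doubling of variables, regularised by sup-convolution. Suppose \<open>f > g\<close> on a small ball around \<open>x0\<close>. Let \<open>U\<close>
  and \<open>V\<close> be the sup-convolutions with parameter \<open>\<epsilon>\<close> of \<open>u\<close> and \<open>- u\<close> on this ball, and maximise
  \<open>U \<xi> + V \<zeta> - |\<xi> - \<zeta>|\<^sup>2 / (2 \<epsilon>) - \<kappa> \<epsilon> |\<xi> - x0|\<^sup>2\<close>. As \<open>u\<close> is locally Lipschitz, at the maximum all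
  points and gradients agree up to \<open>O(\<epsilon>)\<close>, hence so do the directions \<open>b\<close> and \<open>b'\<close> given by \<open>B\<close>.
  Comparing the maximum with its translates by \<open>(t b, t b')\<close> and \<open>(- t b, - t b')\<close> bounds the sum of the
  second difference quotients of \<open>U\<close> along \<open>b\<close> and of \<open>V\<close> along \<open>b'\<close> by \<open>|b - b'|\<^sup>2 / \<epsilon> + O(\<epsilon>) = O(\<epsilon>)\<close>.

  Because the operator sees the Hessian in the single direction \<open>B\<close>, neither Alexandrov's theorem nor Jensen's
  lemma is needed. At the maximum \<open>U\<close> is semiconvex and touched from above by a paraboloid; maximising over a
  cylinder of size \<open>t\<close> around the segment in direction \<open>b\<close> produces a nearby point at which \<open>U\<close> is touched
  from above by a quadratic polynomial whose second derivative along \<open>b\<close> is the second difference quotient at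
  step \<open>t\<close> up to an error \<open>\<eta>\<close>, and whose coefficients stay bounded as \<open>t\<close> tends to 0. Rescaling by \<open>t\<close>
  preserves the constants of semiconvexity and of the paraboloid, so it is enough to do this for \<open>t = 1\<close>. The
  viscosity inequalities at these points, for \<open>U\<close> and \<open>V\<close> with the same \<open>t\<close>, bound \<open>f - g\<close> by \<open>O(\<epsilon>)\<close>.
\<close>

section \<open>Partial derivatives and $C^k$ functions\<close>

lemma pderiv_i_eqI: "(f has_derivative f') (at x) \<Longrightarrow> pderiv_i f i x = f' (axis i 1)"
  by (simp add: pderiv_i_def frechet_derivative_at[symmetric])

lemma grad_eqI: "(f has_derivative (\<lambda>h. v \<bullet> h)) (at x) \<Longrightarrow> grad f x = v"
  by (simp add: grad_def pderiv_i_eqI vec_eq_iff inner_axis)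

lemma Ck_on_Suc_imp_Ck_on: "Ck_on (Suc k) U f \<Longrightarrow> Ck_on k U f"
  by (induction k arbitrary: f) auto

lemma Ck_on_const: "Ck_on k U (\<lambda>x. c)"
proof (induction k arbitrary: c)
  case (Suc k)
  have "pderiv_i (\<lambda>x. c) i = (\<lambda>x. 0)" for i :: 'a
    by (rule ext) (rule pderiv_i_eqI[OF has_derivative_const])
  with Suc show ?case by simp
qed simp

lemma Ck_on_affine:
  assumes "bounded_linear l"
  shows "Ck_on k U (\<lambda>x. l x + c)"
proof -
  have cont: "continuous_on U (\<lambda>x. l x + c)"
    by (intro continuous_intros linear_continuous_on assms)
  have deriv: "((\<lambda>x. l x + c) has_derivative l) (at x)" for x
    using bounded_linear_imp_has_derivative[OF assms] by (rule has_derivative_add_const)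
  then have "pderiv_i (\<lambda>x. l x + c) i = (\<lambda>x. l (axis i 1))" for i
    by (intro ext pderiv_i_eqI)
  then show ?thesis
    using deriv cont by (cases k) (auto simp: Ck_on_const differentiable_def)
qed

lemma Ck_on_cong:
  assumes "open U" "\<And>x. x \<in> U \<Longrightarrow> f x = g x"
  shows "Ck_on k U f \<longleftrightarrow> Ck_on k U g"
proof -
  have "Ck_on k U g" if "Ck_on k U f" "\<And>x. x \<in> U \<Longrightarrow> f x = g x" for f g
    using that
  proof (induction k arbitrary: f g)
    case 0
    then show ?case by (simp cong: continuous_on_cong)
  next
    case (Suc k)
    have "g differentiable (at x)" if "x \<in> U" for x
      using Suc.prems that has_derivative_transform_within_open[OF _ assms(1) that, of f _ UNIV g]
      unfolding differentiable_def Ck_on.simps by blast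
    moreover have "continuous_on U g"
      using Suc.prems by (simp cong: continuous_on_cong)
    moreover have "Ck_on k U (pderiv_i g i)" for i
    proof (rule Suc.IH)
      show "Ck_on k U (pderiv_i f i)" using Suc.prems by simp
      show "pderiv_i f i x = pderiv_i g i x" if "x \<in> U" for x
        using Suc.prems that frechet_derivative_transform_within_open[OF _ assms(1) that, of f g]
        by (simp add: pderiv_i_def)
    qed
    ultimately show ?case by simp
  qed
  from this[of f g] this[of g f] show ?thesis using assms(2) by auto
qed

lemma Ck_on_add:
  assumes "open U" "Ck_on k U f" "Ck_on k U g"
  shows "Ck_on k U (\<lambda>x. f x + g x)"
  using assms(2,3)
proof (induction k arbitrary: f g)
  case (Suc k)
  have "pderiv_i (\<lambda>x. f x + g x) i x = pderiv_i f i x + pderiv_i g i x" if "x \<in> U" for i x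
  proof -
    have "(f has_derivative frechet_derivative f (at x)) (at x)"
      "(g has_derivative frechet_derivative g (at x)) (at x)"
      using Suc.prems that by (auto simp: frechet_derivative_works[symmetric])
    from pderiv_i_eqI[OF has_derivative_add[OF this]] show ?thesis
      by (simp add: pderiv_i_def)
  qed
  then have "Ck_on k U (pderiv_i (\<lambda>x. f x + g x) i)" for i
    using Suc Ck_on_cong[OF assms(1), of "pderiv_i (\<lambda>x. f x + g x) i"] by simp
  then show ?case using Suc.prems by (auto intro: continuous_on_add)
qed (auto intro: continuous_on_add)

lemma Ck_on_mult:
  assumes "open U" "Ck_on k U f" "Ck_on k U g"
  shows "Ck_on k U (\<lambda>x. f x * g x)"
  using assms(2,3)
proof (induction k arbitrary: f g)
  case (Suc k)
  have "pderiv_i (\<lambda>x. f x * g x) i x = f x * pderiv_i g i x + pderiv_i f i x * g x" if "x \<in> U" for i x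
  proof -
    have "(f has_derivative frechet_derivative f (at x)) (at x)"
      "(g has_derivative frechet_derivative g (at x)) (at x)"
      using Suc.prems that by (auto simp: frechet_derivative_works[symmetric])
    from pderiv_i_eqI[OF has_derivative_mult[OF this]] show ?thesis
      by (simp add: pderiv_i_def)
  qed
  moreover have "Ck_on k U (\<lambda>x. f x * pderiv_i g i x + pderiv_i f i x * g x)" for i
    using Suc.prems by (intro Ck_on_add[OF assms(1)] Suc.IH Ck_on_Suc_imp_Ck_on[OF Suc.prems(1)]
        Ck_on_Suc_imp_Ck_on[OF Suc.prems(2)]) auto
  ultimately have "Ck_on k U (pderiv_i (\<lambda>x. f x * g x) i)" for i
    using Ck_on_cong[OF assms(1), of "pderiv_i (\<lambda>x. f x * g x) i"] by simp
  then show ?case using Suc.prems by (auto intro: continuous_on_mult)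
qed (auto intro: continuous_on_mult)

section \<open>Quadratic polynomials and superjets\<close>

definition self_adjoint :: "('a::real_inner \<Rightarrow>\<^sub>L 'a) \<Rightarrow> bool" where
  "self_adjoint X \<longleftrightarrow> (\<forall>x y. X x \<bullet> y = x \<bullet> X y)"

lemma self_adjointD: "self_adjoint X \<Longrightarrow> X x \<bullet> y = x \<bullet> X y"
  by (simp add: self_adjoint_def)

definition quad_poly :: "'a::real_inner \<Rightarrow> ('a \<Rightarrow>\<^sub>L 'a) \<Rightarrow> 'a \<Rightarrow> 'a \<Rightarrow> real" where
  "quad_poly p X a x = p \<bullet> (x - a) + (x - a) \<bullet> X (x - a) / 2"

lemma quad_poly_self [simp]: "quad_poly p X a a = 0"
  by (simp add: quad_poly_def)

lemma uminus_quad_poly: "- quad_poly p X a x = quad_poly (- p) (- X) a x"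
  by (simp add: quad_poly_def blinfun.minus_left)

lemma quad_poly_recenter:
  assumes "self_adjoint X"
  shows "quad_poly p X a y = quad_poly p X a x + quad_poly (p + X (x - a)) X x y"
proof -
  define d e where "d = x - a" and "e = y - x"
  have "y - a = d + e" by (simp add: d_def e_def)
  moreover have "X d \<bullet> e = d \<bullet> X e"
    by (rule self_adjointD[OF assms])
  ultimately show ?thesis
    unfolding quad_poly_def d_def[symmetric] e_def[symmetric]
    by (simp add: blinfun.add_right inner_simps inner_commute field_simps)
qed

lemma has_derivative_quad_poly:
  assumes "self_adjoint X"
  shows "(quad_poly p X a has_derivative (\<lambda>h. (p + X (x - a)) \<bullet> h)) (at x)"
proof -
  have "(x - a) \<bullet> X h = X (x - a) \<bullet> h" for h
    using self_adjointD[OF assms] by simp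
  then show ?thesis
    unfolding quad_poly_def[abs_def]
    by (auto intro!: derivative_eq_intros
        simp: fun_eq_iff inner_add_left inner_commute[of _ "X (x - a)"])
qed

lemma grad_quad_poly: "self_adjoint X \<Longrightarrow> grad (quad_poly p X a) = (\<lambda>x. p + X (x - a))"
  by (intro ext grad_eqI has_derivative_quad_poly)

lemma hess_apply_quad_poly:
  assumes "self_adjoint X"
  shows "hess_apply (quad_poly p X a) x = X"
proof -
  have "((\<lambda>x. p + X (x - a)) has_derivative X) (at x)"
    by (auto intro!: derivative_eq_intros)
  then show ?thesis
    by (simp add: hess_apply_def[abs_def] grad_quad_poly[OF assms] frechet_derivative_at[symmetric])
qed

lemma Ck_on_2_quad_poly:
  fixes p :: "real^'n"
  assumes "self_adjoint X"
  shows "Ck_on 2 U (quad_poly p X a)"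
proof -
  have "pderiv_i (quad_poly p X a) i = (\<lambda>x. X x $ i + (p - X a) $ i)" for i
    by (intro ext)
      (simp add: pderiv_i_eqI[OF has_derivative_quad_poly[OF assms]] inner_axis blinfun.diff_right)
  moreover have "bounded_linear (\<lambda>x. X x $ i)" for i
    by (rule bounded_linear_compose[OF bounded_linear_vec_nth blinfun.bounded_linear_right])
  ultimately have "Ck_on 1 U (pderiv_i (quad_poly p X a) i)" for i
    by (simp only: Ck_on_affine)
  moreover have "quad_poly p X a differentiable at x" for x
    using has_derivative_quad_poly[OF assms] unfolding differentiable_def by blast
  ultimately show ?thesis
    by (simp add: numeral_2_eq_2 continuous_at_imp_continuous_on differentiable_imp_continuous_within)
qed

lemma visc_op_quad_poly:
  assumes "self_adjoint X"
  shows "visc_op B c u (quad_poly p X a) a = B a (u a) p \<bullet> X (B a (u a) p) + c a (u a) p"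
  by (simp add: visc_op_def Let_def grad_quad_poly[OF assms] hess_apply_quad_poly[OF assms]
      blinfun.zero_right)

text \<open>Touching by quadratic polynomials, without the usual error term \<open>o(|y - x|\<^sup>2)\<close>.\<close>

definition superjet :: "'a::real_inner set \<Rightarrow> ('a \<Rightarrow> real) \<Rightarrow> 'a \<Rightarrow> ('a \<times> ('a \<Rightarrow>\<^sub>L 'a)) set" where
  "superjet S v x = {(p, X). self_adjoint X \<and> (\<exists>e>0. \<forall>y\<in>S \<inter> ball x e. v y \<le> v x + quad_poly p X x y)}"

lemma superjetI:
  assumes "self_adjoint X" "e > 0" "\<And>y. y \<in> S \<Longrightarrow> dist x y < e \<Longrightarrow> v y \<le> v x + quad_poly p X x y"
  shows "(p, X) \<in> superjet S v x"
  using assms by (auto simp: superjet_def intro!: exI[of _ e])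

lemma superjetE:
  assumes "(p, X) \<in> superjet S v x"
  obtains e where "self_adjoint X" "e > 0" "\<And>y. y \<in> S \<Longrightarrow> dist x y < e \<Longrightarrow> v y \<le> v x + quad_poly p X x y"
proof -
  from assms obtain e where "self_adjoint X" "e > 0" "\<forall>y\<in>S \<inter> ball x e. v y \<le> v x + quad_poly p X x y"
    by (auto simp: superjet_def)
  then show ?thesis by (intro that[of e]) auto
qed

lemma superjet_interior_subset:
  assumes "x \<in> interior S"
  shows "superjet S v x \<subseteq> superjet T v x"
proof safe
  fix p X assume jet: "(p, X) \<in> superjet S v x"
  obtain e where e: "self_adjoint X" "e > 0"
      "\<And>y. y \<in> S \<Longrightarrow> dist x y < e \<Longrightarrow> v y \<le> v x + quad_poly p X x y"
    by (rule superjetE[OF jet]) (rule that)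
  obtain d where "d > 0" "ball x d \<subseteq> S"
    using assms mem_interior by blast
  then show "(p, X) \<in> superjet T v x"
    using e by (intro superjetI[of X "min d e"]) auto
qed

definition jet_subsolution ::
  "'a::real_inner set \<Rightarrow> ('a \<times> 'a \<Rightarrow> 'a) \<Rightarrow> ('a \<times> 'a \<Rightarrow> real) \<Rightarrow> ('a \<Rightarrow> real) \<Rightarrow> bool" where
  "jet_subsolution \<Omega> \<beta> \<gamma> v \<longleftrightarrow>
    (\<forall>x\<in>\<Omega>. \<forall>p X. (p, X) \<in> superjet \<Omega> v x \<longrightarrow> \<gamma> (x, p) \<le> \<beta> (x, p) \<bullet> X (\<beta> (x, p)))"

definition jet_supersolution ::
  "'a::real_inner set \<Rightarrow> ('a \<times> 'a \<Rightarrow> 'a) \<Rightarrow> ('a \<times> 'a \<Rightarrow> real) \<Rightarrow> ('a \<Rightarrow> real) \<Rightarrow> bool" where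
  "jet_supersolution \<Omega> \<beta> \<gamma> v \<longleftrightarrow>
    jet_subsolution \<Omega> (\<lambda>(x, p). \<beta> (x, - p)) (\<lambda>(x, p). - \<gamma> (x, - p)) (\<lambda>x. - v x)"

lemma jet_subsolutionI:
  assumes "\<And>x p X. x \<in> \<Omega> \<Longrightarrow> (p, X) \<in> superjet \<Omega> v x \<Longrightarrow> \<gamma> (x, p) \<le> \<beta> (x, p) \<bullet> X (\<beta> (x, p))"
  shows "jet_subsolution \<Omega> \<beta> \<gamma> v"
  unfolding jet_subsolution_def using assms by blast

lemma jet_subsolutionD:
  assumes "jet_subsolution \<Omega> \<beta> \<gamma> v" "x \<in> \<Omega>" "(p, X) \<in> superjet \<Omega> v x"
  shows "\<gamma> (x, p) \<le> \<beta> (x, p) \<bullet> X (\<beta> (x, p))"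
  using assms unfolding jet_subsolution_def by blast

lemma jet_subsolution_subset:
  assumes "jet_subsolution \<Omega> \<beta> \<gamma> v" "open U" "U \<subseteq> \<Omega>"
  shows "jet_subsolution U \<beta> \<gamma> v"
proof (rule jet_subsolutionI)
  fix x p X assume x: "x \<in> U" and "(p, X) \<in> superjet U v x"
  then have "(p, X) \<in> superjet \<Omega> v x"
    using superjet_interior_subset[of x U v \<Omega>] assms(2) unfolding interior_open[OF assms(2)] by blast
  then show "\<gamma> (x, p) \<le> \<beta> (x, p) \<bullet> X (\<beta> (x, p))"
    using x assms(3) by (intro jet_subsolutionD[OF assms(1)]) auto
qed

lemma jet_supersolution_subset:
  "jet_supersolution \<Omega> \<beta> \<gamma> v \<Longrightarrow> open U \<Longrightarrow> U \<subseteq> \<Omega> \<Longrightarrow> jet_supersolution U \<beta> \<gamma> v"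
  unfolding jet_supersolution_def by (rule jet_subsolution_subset)

lemma visc_sub_imp_jet_subsolution:
  assumes "visc_sub \<Omega> B c h u"
  shows "jet_subsolution \<Omega> (\<lambda>(x, p). B x (u x) p) (\<lambda>(x, p). h x - c x (u x) p) u"
proof (rule jet_subsolutionI)
  fix x p X assume x: "x \<in> \<Omega>" and jet: "(p, X) \<in> superjet \<Omega> u x"
  obtain e where X: "self_adjoint X" and e: "e > 0"
      "\<And>y. y \<in> \<Omega> \<Longrightarrow> dist x y < e \<Longrightarrow> u y \<le> u x + quad_poly p X x y"
    by (rule superjetE[OF jet]) (rule that)
  then have "local_max_at \<Omega> (\<lambda>y. u y - quad_poly p X x y) x"
    by (auto simp: local_max_at_def algebra_simps intro!: exI[of _ e])
  then have "h x \<le> visc_op B c u (quad_poly p X x) x"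
    using assms x Ck_on_2_quad_poly[OF X] unfolding visc_sub_def by blast
  then show "(\<lambda>(x, p). h x - c x (u x) p) (x, p)
      \<le> (\<lambda>(x, p). B x (u x) p) (x, p) \<bullet> X ((\<lambda>(x, p). B x (u x) p) (x, p))"
    by (simp add: visc_op_quad_poly[OF X])
qed

lemma visc_super_imp_jet_supersolution:
  assumes "visc_super \<Omega> B c h u"
  shows "jet_supersolution \<Omega> (\<lambda>(x, p). B x (u x) p) (\<lambda>(x, p). h x - c x (u x) p) u"
  unfolding jet_supersolution_def
proof (rule jet_subsolutionI)
  fix x p X assume x: "x \<in> \<Omega>" and jet: "(p, X) \<in> superjet \<Omega> (\<lambda>x. - u x) x"
  obtain e where X: "self_adjoint X" and e: "e > 0"
      "\<And>y. y \<in> \<Omega> \<Longrightarrow> dist x y < e \<Longrightarrow> - u y \<le> - u x + quad_poly p X x y"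
    by (rule superjetE[OF jet]) (rule that)
  have X': "self_adjoint (- X)"
    using X by (simp add: self_adjoint_def blinfun.minus_left)
  have "local_min_at \<Omega> (\<lambda>y. u y - quad_poly (- p) (- X) x y) x"
    using e by (auto simp: local_min_at_def uminus_quad_poly[symmetric] algebra_simps intro!: exI[of _ e])
  then have "visc_op B c u (quad_poly (- p) (- X) x) x \<le> h x"
    using assms x Ck_on_2_quad_poly[OF X'] unfolding visc_super_def by blast
  then have "- (h x - c x (u x) (- p)) \<le> B x (u x) (- p) \<bullet> X (B x (u x) (- p))"
    by (simp add: visc_op_quad_poly[OF X'] blinfun.minus_left)
  then show "(\<lambda>(x, p). - (\<lambda>(x, p). h x - c x (u x) p) (x, - p)) (x, p)
      \<le> (\<lambda>(x, p). (\<lambda>(x, p). B x (u x) p) (x, - p)) (x, p) \<bullet>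
        X ((\<lambda>(x, p). (\<lambda>(x, p). B x (u x) p) (x, - p)) (x, p))"
    by simp
qed

section \<open>Semiconvex functions\<close>

definition semiconvex :: "real \<Rightarrow> ('a::real_inner \<Rightarrow> real) \<Rightarrow> bool" where
  "semiconvex m f \<longleftrightarrow> (\<forall>a b. \<forall>t\<in>{0..1}. f ((1 - t) *\<^sub>R a + t *\<^sub>R b)
     \<le> (1 - t) * f a + t * f b + m * (t * (1 - t)) * (norm (a - b))\<^sup>2)"

lemma semiconvexD:
  "semiconvex m f \<Longrightarrow> 0 \<le> t \<Longrightarrow> t \<le> 1 \<Longrightarrow>
    f ((1 - t) *\<^sub>R a + t *\<^sub>R b) \<le> (1 - t) * f a + t * f b + m * (t * (1 - t)) * (norm (a - b))\<^sup>2"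
  by (simp add: semiconvex_def)

lemma norm_convex_combination_sq:
  fixes a b :: "'a::real_inner"
  shows "(norm ((1 - t) *\<^sub>R a + t *\<^sub>R b))\<^sup>2 =
    (1 - t) * (norm a)\<^sup>2 + t * (norm b)\<^sup>2 - t * (1 - t) * (norm (a - b))\<^sup>2"
  by (simp add: power2_norm_eq_inner inner_simps inner_commute algebra_simps)

lemma semiconvex_imp_continuous_on:
  fixes f :: "'a::euclidean_space \<Rightarrow> real"
  assumes "semiconvex m f"
  shows "continuous_on S f"
proof -
  have "convex_on UNIV (\<lambda>x. f x + m * (norm x)\<^sup>2)"
  proof (rule convex_onI)
    fix t :: real and a b :: 'a assume "0 < t" "t < 1"
    then show "f ((1 - t) *\<^sub>R a + t *\<^sub>R b) + m * (norm ((1 - t) *\<^sub>R a + t *\<^sub>R b))\<^sup>2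
        \<le> (1 - t) * (f a + m * (norm a)\<^sup>2) + t * (f b + m * (norm b)\<^sup>2)"
      unfolding norm_convex_combination_sq
      using semiconvexD[OF assms, of t a b] by (simp add: algebra_simps)
  qed simp
  then have "continuous_on UNIV (\<lambda>x. (f x + m * (norm x)\<^sup>2) - m * (norm x)\<^sup>2)"
    by (intro continuous_on_diff convex_on_continuous[OF open_UNIV] continuous_intros)
  then show ?thesis
    by (auto intro: continuous_on_subset)
qed

lemma semiconvex_increment_le:
  assumes f: "semiconvex m f" and m: "m \<ge> 0" and bound: "\<And>h. \<bar>f h\<bar> \<le> C * (norm h)\<^sup>2"
  shows "f (a + k) - f a \<le> (5 * C + m) * norm k * (norm a + norm k)"
proof (cases "k = 0")
  case False
  define r where "r = norm a + norm k"
  define t where "t = norm k / r"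
  define k' where "k' = (1 / t) *\<^sub>R k"
  have r: "r > 0" and t: "0 < t" "t \<le> 1"
    using False by (auto simp: r_def t_def add_nonneg_pos)
  have k': "norm k' = r" "t *\<^sub>R k' = k"
    using False r t by (auto simp: k'_def t_def)
  have C: "C \<ge> 0"
    using order_trans[OF abs_ge_zero bound[of k]] False by (simp add: zero_le_mult_iff)
  have "(1 - t) *\<^sub>R a + t *\<^sub>R (a + k') = a + k"
    using k'(2) by (simp add: algebra_simps)
  then have "f (a + k) - f a \<le> t * (f (a + k') - f a) + m * (t * (1 - t)) * r\<^sup>2"
    using semiconvexD[OF f, of t a "a + k'"] t k'(1) by (simp add: algebra_simps)
  also have "\<dots> \<le> t * (C * (2 * r)\<^sup>2 + C * r\<^sup>2) + m * (t * 1) * r\<^sup>2"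
  proof (intro add_mono mult_left_mono mult_right_mono)
    have "norm a \<le> r" by (simp add: r_def)
    moreover from this have "norm (a + k') \<le> 2 * r"
      using norm_triangle_ineq[of a k'] k'(1) by linarith
    ultimately have "(norm a)\<^sup>2 \<le> r\<^sup>2" "(norm (a + k'))\<^sup>2 \<le> (2 * r)\<^sup>2"
      by (meson norm_ge_zero power_mono)+
    from this[THEN mult_left_mono, OF C]
    show "f (a + k') - f a \<le> C * (2 * r)\<^sup>2 + C * r\<^sup>2"
      using bound[of a] bound[of "a + k'"] by linarith
  qed (use t m in auto)
  also have "\<dots> = (5 * C + m) * (t * r) * r"
    by (simp add: power2_eq_square algebra_simps)
  also have "t * r = norm k"
    using r by (simp add: t_def)
  finally show ?thesis by (simp add: r_def)
qed simp

definition blowup :: "('a::real_inner \<Rightarrow> real) \<Rightarrow> 'a \<Rightarrow> 'a \<Rightarrow> real \<Rightarrow> 'a \<Rightarrow> real" where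
  "blowup f x p t h = (f (x + t *\<^sub>R h) - f x - t * (p \<bullet> h)) / t\<^sup>2"

definition second_difference :: "('a::real_vector \<Rightarrow> real) \<Rightarrow> 'a \<Rightarrow> 'a \<Rightarrow> real" where
  "second_difference f x h = f (x + h) + f (x - h) - 2 * f x"

lemma blowup_add_blowup_uminus:
  "blowup f x p t h + blowup f x p t (- h) = second_difference f x (t *\<^sub>R h) / t\<^sup>2"
  by (simp add: blowup_def second_difference_def add_divide_distrib[symmetric])

lemma blowup_expansion:
  "t \<noteq> 0 \<Longrightarrow> f (x + t *\<^sub>R h) = f x + t * (p \<bullet> h) + t\<^sup>2 * blowup f x p t h"
  by (simp add: blowup_def)

lemma semiconvex_blowup:
  assumes f: "semiconvex m f" and t: "t > 0"
  shows "semiconvex m (blowup f x p t)"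
  unfolding semiconvex_def
proof safe
  fix a b :: 'a and s :: real assume s: "s \<in> {0..1}"
  let ?g = "\<lambda>h. f (x + t *\<^sub>R h)" and ?c = "(1 - s) *\<^sub>R a + s *\<^sub>R b"
  have "(1 - s) *\<^sub>R (x + t *\<^sub>R a) + s *\<^sub>R (x + t *\<^sub>R b) = x + t *\<^sub>R ?c"
    by (simp add: algebra_simps)
  moreover have "(norm (x + t *\<^sub>R a - (x + t *\<^sub>R b)))\<^sup>2 = t\<^sup>2 * (norm (a - b))\<^sup>2"
    by (simp add: scaleR_diff_right[symmetric] power_mult_distrib)
  ultimately have "?g ?c \<le> (1 - s) * ?g a + s * ?g b + t\<^sup>2 * (m * (s * (1 - s)) * (norm (a - b))\<^sup>2)"
    using semiconvexD[OF f, of s "x + t *\<^sub>R a" "x + t *\<^sub>R b"] s by (simp add: mult_ac)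
  then have "?g ?c - f x - t * (p \<bullet> ?c) \<le> (1 - s) * (?g a - f x - t * (p \<bullet> a))
      + s * (?g b - f x - t * (p \<bullet> b)) + t\<^sup>2 * (m * (s * (1 - s)) * (norm (a - b))\<^sup>2)"
    by (simp add: inner_simps algebra_simps)
  from divide_right_mono[OF this, of "t\<^sup>2"]
  show "blowup f x p t ?c \<le> (1 - s) * blowup f x p t a + s * blowup f x p t b
      + m * (s * (1 - s)) * (norm (a - b))\<^sup>2"
    using t by (simp add: blowup_def add_divide_distrib)
qed

lemma superjet_blowup:
  assumes jet: "(q, X) \<in> superjet UNIV (blowup f x p t) h" and t: "t > 0"
  shows "(p + t *\<^sub>R q, X) \<in> superjet UNIV f (x + t *\<^sub>R h)"
proof -
  obtain e where X: "self_adjoint X" and e: "e > 0" "\<And>y. y \<in> UNIV \<Longrightarrow> dist h y < e \<Longrightarrow>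
      blowup f x p t y \<le> blowup f x p t h + quad_poly q X h y"
    by (rule superjetE[OF jet]) (rule that)
  show ?thesis
  proof (rule superjetI[OF X, of "t * e"])
    fix y assume y: "dist (x + t *\<^sub>R h) y < t * e"
    define z where "z = (y - x) /\<^sub>R t"
    have y_eq: "y = x + t *\<^sub>R z" and y_diff: "y - (x + t *\<^sub>R h) = t *\<^sub>R (z - h)"
      using t by (auto simp: z_def algebra_simps)
    have "dist (x + t *\<^sub>R h) y = t * dist h z"
      using t by (simp add: y_eq dist_norm scaleR_diff_right[symmetric])
    then have "blowup f x p t z \<le> blowup f x p t h + quad_poly q X h z"
      using y t by (intro e) auto
    then have "t\<^sup>2 * blowup f x p t z \<le> t\<^sup>2 * blowup f x p t h + t\<^sup>2 * quad_poly q X h z"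
      unfolding distrib_left[symmetric] by (rule mult_left_mono) simp
    then have "f y \<le> f (x + t *\<^sub>R h) + t * (p \<bullet> (z - h)) + t\<^sup>2 * quad_poly q X h z"
      using blowup_expansion[of t f x z p] blowup_expansion[of t f x h p] t
      by (simp add: y_eq inner_diff_right algebra_simps)
    then show "f y \<le> f (x + t *\<^sub>R h) + quad_poly (p + t *\<^sub>R q) X (x + t *\<^sub>R h) y"
      unfolding quad_poly_def y_diff
      by (simp add: inner_add_left blinfun.scaleR_right power2_eq_square distrib_left mult.assoc)
  qed (use t e in auto)
qed

section \<open>Superjets at the maximum over a cylinder\<close>

lemma exists_superjet_of_barrier:
  fixes f :: "'a::real_inner \<Rightarrow> real"
  assumes X: "self_adjoint X" and T: "compact T" "z \<in> T" and f: "continuous_on T f"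
    and ge: "f z \<ge> quad_poly p X a z"
    and less: "\<And>x. x \<in> T \<Longrightarrow> x \<notin> interior T \<Longrightarrow> f x < quad_poly p X a x"
  obtains x where "x \<in> T" "(p + X (x - a), X) \<in> superjet UNIV f x"
proof -
  have "continuous_on T (\<lambda>x. f x - quad_poly p X a x)"
    by (intro continuous_on_diff f continuous_at_imp_continuous_on ballI
        has_derivative_continuous[OF has_derivative_quad_poly[OF X]])
  with continuous_attains_sup[OF T(1)] T(2)
  obtain x where x: "x \<in> T" "\<forall>y\<in>T. f y - quad_poly p X a y \<le> f x - quad_poly p X a x"
    by blast
  have "x \<in> interior T"
    using less[OF x(1)] x(2) T(2) ge by force
  moreover have "(p + X (x - a), X) \<in> superjet T f x"
  proof (rule superjetI[OF X zero_less_one])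
    fix y assume "y \<in> T"
    then show "f y \<le> f x + quad_poly (p + X (x - a)) X x y"
      using x(2) quad_poly_recenter[OF X, of p a y x] by force
  qed
  ultimately show ?thesis
    using superjet_interior_subset x(1) that by blast
qed

definition axial_coord :: "'a::real_inner \<Rightarrow> 'a \<Rightarrow> real" where
  "axial_coord b h = (h \<bullet> b) / (b \<bullet> b)"

definition axial_perp :: "'a::real_inner \<Rightarrow> 'a \<Rightarrow> 'a" where
  "axial_perp b h = h - axial_coord b h *\<^sub>R b"

definition cylinder :: "'a::real_inner \<Rightarrow> 'a set" where
  "cylinder b = {h. \<bar>axial_coord b h\<bar> \<le> 1 \<and> norm (axial_perp b h) \<le> 1}"

lemma axial_decomposition: "h = axial_coord b h *\<^sub>R b + axial_perp b h"
  by (simp add: axial_perp_def)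

lemma axial_perp_inner: "axial_perp b h \<bullet> b = 0"
  by (simp add: axial_perp_def axial_coord_def inner_diff_left)

lemma inner_eq_axial_coord: "h \<bullet> b = axial_coord b h * (b \<bullet> b)"
  by (simp add: axial_coord_def)

lemma norm_sq_axial_decomposition:
  "(norm h)\<^sup>2 = (axial_coord b h)\<^sup>2 * (b \<bullet> b) + (norm (axial_perp b h))\<^sup>2"
proof -
  have "(norm (axial_coord b h *\<^sub>R b + axial_perp b h))\<^sup>2
      = (axial_coord b h)\<^sup>2 * (b \<bullet> b) + (norm (axial_perp b h))\<^sup>2"
    using axial_perp_inner[of b h]
    by (simp add: power2_norm_eq_inner inner_simps inner_commute) (simp add: power2_eq_square)
  then show ?thesis
    by (simp flip: axial_decomposition)
qed

lemma continuous_on_axial [continuous_intros]: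
  "continuous_on S (axial_coord b)" "continuous_on S (axial_perp b)"
  unfolding axial_perp_def axial_coord_def divide_inverse by (intro continuous_intros)+

lemma norm_le_cylinder:
  assumes "h \<in> cylinder b"
  shows "norm h \<le> norm b + 1"
proof -
  have "norm h \<le> norm (axial_coord b h *\<^sub>R b) + norm (axial_perp b h)"
    by (metis axial_decomposition norm_triangle_ineq)
  also have "\<dots> \<le> 1 * norm b + 1"
    unfolding norm_scaleR using assms by (intro add_mono mult_right_mono) (auto simp: cylinder_def)
  finally show ?thesis by simp
qed

lemma compact_cylinder: "compact (cylinder (b :: 'a::euclidean_space))"
proof -
  have "closed (cylinder b)"
    unfolding cylinder_def by (intro closed_Collect_conj closed_Collect_le continuous_intros)
  moreover have "bounded (cylinder b)"
    using norm_le_cylinder by (auto simp: bounded_iff)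
  ultimately show ?thesis by (simp add: compact_eq_bounded_closed)
qed

lemma cylinder_boundary:
  assumes "h \<in> cylinder b" "h \<notin> interior (cylinder b)"
  shows "\<bar>axial_coord b h\<bar> = 1 \<or> norm (axial_perp b h) = 1"
proof -
  have "open {h. \<bar>axial_coord b h\<bar> < 1 \<and> norm (axial_perp b h) < 1}"
    by (intro open_Collect_conj open_Collect_less continuous_intros)
  then have "{h. \<bar>axial_coord b h\<bar> < 1 \<and> norm (axial_perp b h) < 1} \<subseteq> interior (cylinder b)"
    by (intro interior_maximal) (auto simp: cylinder_def)
  then show ?thesis
    using assms by (force simp: cylinder_def)
qed

definition axial_blinfun :: "'a::real_inner \<Rightarrow> real \<Rightarrow> real \<Rightarrow> 'a \<Rightarrow>\<^sub>L 'a" where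
  "axial_blinfun b \<alpha> m = \<alpha> *\<^sub>R (blinfun_scaleR_left b o\<^sub>L blinfun_inner_left b) + m *\<^sub>R id_blinfun"

lemma axial_blinfun_apply: "axial_blinfun b \<alpha> m h = (\<alpha> * (h \<bullet> b)) *\<^sub>R b + m *\<^sub>R h"
  by (simp add: axial_blinfun_def blinfun.add_left blinfun.scaleR_left)

lemma self_adjoint_axial_blinfun: "self_adjoint (axial_blinfun b \<alpha> m)"
  by (simp add: self_adjoint_def axial_blinfun_apply inner_simps inner_commute)

lemma norm_axial_blinfun_le: "norm (axial_blinfun b \<alpha> m) \<le> \<bar>\<alpha>\<bar> * (b \<bullet> b) + \<bar>m\<bar>"
proof (rule norm_blinfun_bound)
  fix h
  have "norm (axial_blinfun b \<alpha> m h) \<le> \<bar>\<alpha>\<bar> * \<bar>h \<bullet> b\<bar> * norm b + \<bar>m\<bar> * norm h"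
    unfolding axial_blinfun_apply by (rule order_trans[OF norm_triangle_ineq]) (simp add: abs_mult)
  also have "\<dots> \<le> \<bar>\<alpha>\<bar> * (norm h * norm b) * norm b + \<bar>m\<bar> * norm h"
    by (intro add_mono mult_right_mono mult_left_mono Cauchy_Schwarz_ineq2) auto
  also have "\<dots> = (\<bar>\<alpha>\<bar> * (b \<bullet> b) + \<bar>m\<bar>) * norm h"
    by (simp add: power2_norm_eq_inner[symmetric] power2_eq_square algebra_simps)
  finally show "norm (axial_blinfun b \<alpha> m h) \<le> (\<bar>\<alpha>\<bar> * (b \<bullet> b) + \<bar>m\<bar>) * norm h" .
qed simp

lemma quad_poly_axial:
  "quad_poly (l *\<^sub>R b) (axial_blinfun b \<alpha> (2 * M)) 0 h =
     l * (b \<bullet> b) * axial_coord b h + (\<alpha> * (b \<bullet> b)\<^sup>2 + 2 * M * (b \<bullet> b)) / 2 * (axial_coord b h)\<^sup>2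
       + M * (norm (axial_perp b h))\<^sup>2"
proof -
  have "quad_poly (l *\<^sub>R b) (axial_blinfun b \<alpha> (2 * M)) 0 h =
      l * (h \<bullet> b) + \<alpha> / 2 * (h \<bullet> b)\<^sup>2 + M * (norm h)\<^sup>2"
    unfolding power2_norm_eq_inner
    by (simp add: quad_poly_def axial_blinfun_apply inner_simps inner_commute[of b] power2_eq_square
        add_divide_distrib)
  then show ?thesis
    unfolding inner_eq_axial_coord[of h b] norm_sq_axial_decomposition[of h b]
    by (simp add: power2_eq_square algebra_simps)
qed

lemma semiconvex_increment_less:
  fixes a k :: "'a::real_inner"
  assumes f: "semiconvex m f" and m: "m \<ge> 0" and bound: "\<And>h. \<bar>f h\<bar> \<le> C * (norm h)\<^sup>2" and \<eta>: "\<eta> > 0"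
    and D: "D = 5 * C + m" and M: "M \<ge> D + (D * norm a)\<^sup>2 / \<eta>"
  shows "f (a + k) < f a + \<eta> / 2 + M * (norm k)\<^sup>2"
proof -
  have young: "x \<le> \<eta> / 4 + x\<^sup>2 / \<eta>" for x :: real
  proof -
    have "0 \<le> (\<eta> / 2 - x)\<^sup>2" by simp
    then show ?thesis using \<eta> by (simp add: power2_eq_square field_simps)
  qed
  have "f (a + k) - f a \<le> D * norm a * norm k + D * (norm k)\<^sup>2"
    using semiconvex_increment_le[OF f m bound, of a k] by (simp add: D power2_eq_square algebra_simps)
  also have "\<dots> \<le> \<eta> / 4 + (D * norm a * norm k)\<^sup>2 / \<eta> + D * (norm k)\<^sup>2"
    by (intro add_right_mono young)
  also have "\<dots> = \<eta> / 4 + (D + (D * norm a)\<^sup>2 / \<eta>) * (norm k)\<^sup>2"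
    by (simp add: power_mult_distrib algebra_simps)
  also have "\<dots> \<le> \<eta> / 4 + M * (norm k)\<^sup>2"
    using M by (intro add_left_mono mult_right_mono) auto
  finally show ?thesis using \<eta> by simp
qed

text \<open>The barrier \<open>quad_poly (l *\<^sub>R b) X 0\<close> interpolates \<open>f\<close> at \<open>b\<close> and \<open>- b\<close> up to an excess of \<open>\<eta> / 2\<close>;
  its large coefficient \<open>M\<close> transversally to \<open>b\<close> lifts it above \<open>f\<close> on the rest of the boundary.\<close>

context
  fixes f :: "'a::euclidean_space \<Rightarrow> real" and b :: 'a and m C \<eta> D M l \<alpha> :: real and X :: "'a \<Rightarrow>\<^sub>L 'a"
  assumes f: "semiconvex m f" and m: "m \<ge> 0" and C: "C \<ge> 0" and \<eta>: "\<eta> > 0"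
    and bound: "\<And>h. \<bar>f h\<bar> \<le> C * (norm h)\<^sup>2"
    and D: "D = 5 * C + m"
    and M: "M = 1 + D + (D * norm b)\<^sup>2 / \<eta> + C * (norm b + 1)\<^sup>2 + 2 * C * (b \<bullet> b)"
    and l: "l = (f b - f (- b)) / (2 * (b \<bullet> b))"
    and \<alpha>: "\<alpha> = (f b + f (- b) + \<eta> - 2 * M * (b \<bullet> b)) / (b \<bullet> b)\<^sup>2"
    and X: "X = axial_blinfun b \<alpha> (2 * M)"
begin

lemma barrier_constants_nonneg:
  "0 \<le> D" "0 \<le> (D * norm b)\<^sup>2 / \<eta>" "0 \<le> C * (norm b + 1)\<^sup>2" "0 \<le> C * (b \<bullet> b)"
  using C m \<eta> by (auto simp: D)

lemma abs_values_at_ends_le: "\<bar>f b\<bar> \<le> C * (b \<bullet> b)" "\<bar>f (- b)\<bar> \<le> C * (b \<bullet> b)"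
  using bound[of b] bound[of "- b"] by (auto simp: power2_norm_eq_inner)

lemma barrier_eq:
  assumes "b \<noteq> 0"
  shows "quad_poly (l *\<^sub>R b) X 0 h = (f b - f (- b)) / 2 * axial_coord b h
    + (f b + f (- b) + \<eta>) / 2 * (axial_coord b h)\<^sup>2 + M * (norm (axial_perp b h))\<^sup>2"
  using assms by (simp add: X quad_poly_axial l \<alpha>)

lemma less_barrier_on_caps:
  assumes "\<bar>axial_coord b h\<bar> = 1"
  shows "f h < quad_poly (l *\<^sub>R b) X 0 h"
proof -
  let ?s = "axial_coord b h" and ?k = "axial_perp b h"
  have s: "?s = 1 \<or> ?s = - 1" using assms by linarith
  then have b: "b \<noteq> 0" by (auto simp: axial_coord_def)
  have "f h = f (?s *\<^sub>R b + ?k)" by (simp flip: axial_decomposition)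
  also have "\<dots> < f (?s *\<^sub>R b) + \<eta> / 2 + M * (norm ?k)\<^sup>2"
    using s barrier_constants_nonneg by (intro semiconvex_increment_less[OF f m bound \<eta> D]) (auto simp: M)
  also have "\<dots> = quad_poly (l *\<^sub>R b) X 0 h"
    unfolding barrier_eq[OF b] using s by (auto simp: field_simps)
  finally show ?thesis .
qed

lemma less_barrier_on_side:
  assumes h: "h \<in> cylinder b" and k: "norm (axial_perp b h) = 1"
  shows "f h < quad_poly (l *\<^sub>R b) X 0 h"
proof -
  let ?s = "axial_coord b h"
  have s: "\<bar>?s\<bar> \<le> 1" using h by (simp add: cylinder_def)
  have "f h \<le> C * (norm h)\<^sup>2" using bound[of h] by simp
  also have "\<dots> \<le> C * (norm b + 1)\<^sup>2"
    using C norm_le_cylinder[OF h] by (intro mult_left_mono power_mono) auto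
  also have "\<dots> < M - 2 * C * (b \<bullet> b)"
    using barrier_constants_nonneg by (simp add: M)
  also have "\<dots> \<le> quad_poly (l *\<^sub>R b) X 0 h"
  proof (cases "b = 0")
    case True
    then show ?thesis unfolding X quad_poly_axial using k by simp
  next
    case b: False
    have "\<bar>(f b - f (- b)) / 2 * ?s\<bar> \<le> (C * (b \<bullet> b)) * 1"
      unfolding abs_mult using abs_values_at_ends_le s barrier_constants_nonneg by (intro mult_mono) auto
    moreover have "- (C * (b \<bullet> b)) * ?s\<^sup>2 \<le> (f b + f (- b) + \<eta>) / 2 * ?s\<^sup>2"
      using abs_values_at_ends_le \<eta> by (intro mult_right_mono) auto
    moreover have "(C * (b \<bullet> b)) * ?s\<^sup>2 \<le> (C * (b \<bullet> b)) * 1"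
      using s barrier_constants_nonneg by (intro mult_left_mono) (auto simp: abs_square_le_1)
    ultimately show ?thesis
      unfolding barrier_eq[OF b] k by simp
  qed
  finally show ?thesis .
qed

lemma exists_superjet_in_cylinder:
  "\<exists>h\<in>cylinder b. (l *\<^sub>R b + X h, X) \<in> superjet UNIV f h"
proof (rule exists_superjet_of_barrier[OF _ compact_cylinder _ semiconvex_imp_continuous_on[OF f]])
  show "self_adjoint X" by (simp add: X self_adjoint_axial_blinfun)
  show "0 \<in> cylinder b" by (simp add: cylinder_def axial_coord_def axial_perp_def)
  show "quad_poly (l *\<^sub>R b) X 0 0 \<le> f 0" using bound[of 0] by simp
  show "f h < quad_poly (l *\<^sub>R b) X 0 h" if "h \<in> cylinder b" "h \<notin> interior (cylinder b)" for h
    using cylinder_boundary[OF that] less_barrier_on_caps less_barrier_on_side[OF that(1)] by blast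
qed auto

lemma norm_barrier_slope_le: "norm (l *\<^sub>R b) \<le> C * norm b"
proof -
  have "\<bar>l\<bar> \<le> C"
    using abs_values_at_ends_le C by (cases "b = 0") (auto simp: l field_simps)
  then show ?thesis by (simp add: mult_right_mono)
qed

lemma norm_barrier_hessian_le:
  "norm X \<le> (2 * C * (b \<bullet> b) + \<eta> + 2 * M * (b \<bullet> b)) / (b \<bullet> b)\<^sup>2 * (b \<bullet> b) + 2 * M"
proof -
  have M0: "M \<ge> 0" using barrier_constants_nonneg by (simp add: M)
  then have "0 \<le> M * (b \<bullet> b)" by simp
  then have "\<bar>f b + f (- b) + \<eta> - 2 * M * (b \<bullet> b)\<bar> \<le> 2 * C * (b \<bullet> b) + \<eta> + 2 * M * (b \<bullet> b)"
    using abs_values_at_ends_le \<eta> by linarith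
  then have "\<bar>\<alpha>\<bar> * (b \<bullet> b) + \<bar>2 * M\<bar>
      \<le> (2 * C * (b \<bullet> b) + \<eta> + 2 * M * (b \<bullet> b)) / (b \<bullet> b)\<^sup>2 * (b \<bullet> b) + 2 * M"
    using M0 by (auto simp: \<alpha> intro!: mult_right_mono divide_right_mono)
  then show ?thesis
    using norm_axial_blinfun_le[of b \<alpha> "2 * M"] by (simp add: X)
qed

lemma barrier_hessian_axial_le: "b \<bullet> X b \<le> f b + f (- b) + \<eta>"
  using abs_values_at_ends_le \<eta> by (cases "b = 0")
    (auto simp: X \<alpha> axial_blinfun_apply inner_add_right power2_eq_square field_simps)

end

text \<open>A mean value argument in place of second differentiability: \<open>b \<bullet> X b\<close> is controlled by the second
  difference along \<open>b\<close> alone, whereas for \<open>X\<close> as a whole a bound suffices.\<close>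

lemma semiconvex_exists_superjet:
  fixes b :: "'a::euclidean_space"
  assumes m: "m \<ge> 0" and C: "C \<ge> 0" and \<eta>: "\<eta> > 0"
  shows "\<exists>K. \<forall>f. semiconvex m f \<and> (\<forall>h. \<bar>f h\<bar> \<le> C * (norm h)\<^sup>2) \<longrightarrow>
    (\<exists>h q X. (q, X) \<in> superjet UNIV f h \<and> norm h \<le> K \<and> norm q \<le> K \<and> norm X \<le> K \<and>
      b \<bullet> X b \<le> f b + f (- b) + \<eta>)"
proof -
  define D where "D = 5 * C + m"
  define M where "M = 1 + D + (D * norm b)\<^sup>2 / \<eta> + C * (norm b + 1)\<^sup>2 + 2 * C * (b \<bullet> b)"
  define N where "N = (2 * C * (b \<bullet> b) + \<eta> + 2 * M * (b \<bullet> b)) / (b \<bullet> b)\<^sup>2 * (b \<bullet> b) + 2 * M"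
  define K where "K = (norm b + 1) + (C * norm b + N * (norm b + 1)) + N"
  have "M \<ge> 0" using m C \<eta> by (simp add: M_def D_def)
  then have N: "N \<ge> 0" using C \<eta> by (simp add: N_def)
  have "\<exists>h q X. (q, X) \<in> superjet UNIV f h \<and> norm h \<le> K \<and> norm q \<le> K \<and> norm X \<le> K \<and>
      b \<bullet> X b \<le> f b + f (- b) + \<eta>"
    if f: "semiconvex m f" and bound: "\<And>h. \<bar>f h\<bar> \<le> C * (norm h)\<^sup>2" for f
  proof -
    define l where "l = (f b - f (- b)) / (2 * (b \<bullet> b))"
    define \<alpha> where "\<alpha> = (f b + f (- b) + \<eta> - 2 * M * (b \<bullet> b)) / (b \<bullet> b)\<^sup>2"
    define X where "X = axial_blinfun b \<alpha> (2 * M)"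
    note barrier = f m C \<eta> bound D_def M_def l_def \<alpha>_def X_def
    note X_le = norm_barrier_hessian_le[OF barrier, folded N_def]
    obtain h where h: "h \<in> cylinder b" and jet: "(l *\<^sub>R b + X h, X) \<in> superjet UNIV f h"
      using exists_superjet_in_cylinder[OF barrier] by blast
    have h_le: "norm h \<le> norm b + 1" by (rule norm_le_cylinder[OF h])
    have "norm (l *\<^sub>R b + X h) \<le> norm (l *\<^sub>R b) + norm X * norm h"
      by (intro norm_triangle_mono norm_blinfun) simp
    also have "\<dots> \<le> C * norm b + N * (norm b + 1)"
      using norm_barrier_slope_le[OF barrier] X_le h_le N by (intro add_mono mult_mono) auto
    finally have "norm (l *\<^sub>R b + X h) \<le> C * norm b + N * (norm b + 1)" .
    moreover have "0 \<le> C * norm b" "0 \<le> N * (norm b + 1)"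
      using C N by auto
    ultimately have "norm h \<le> K" "norm (l *\<^sub>R b + X h) \<le> K" "norm X \<le> K"
      using h_le X_le N norm_ge_zero[of b] unfolding K_def by linarith+
    then show ?thesis
      using jet barrier_hessian_axial_le[OF barrier] by auto
  qed
  then show ?thesis by blast
qed

lemma semiconvex_superjets_second_difference:
  fixes f :: "'a::euclidean_space \<Rightarrow> real"
  assumes f: "semiconvex m f" and m: "m \<ge> 0" and C: "C \<ge> 0" and \<eta>: "\<eta> > 0"
    and bound: "\<And>h. \<bar>f (x + h) - f x - p \<bullet> h\<bar> \<le> C * (norm h)\<^sup>2"
  shows "\<exists>K. \<forall>t>0. \<exists>h q X. (q, X) \<in> superjet UNIV f (x + h) \<and>
    norm h \<le> K * t \<and> norm (q - p) \<le> K * t \<and> norm X \<le> K \<and>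
    b \<bullet> X b \<le> second_difference f x (t *\<^sub>R b) / t\<^sup>2 + \<eta>"
proof -
  obtain K where K: "\<forall>f. semiconvex m f \<and> (\<forall>h. \<bar>f h\<bar> \<le> C * (norm h)\<^sup>2) \<longrightarrow>
    (\<exists>h q X. (q, X) \<in> superjet UNIV f h \<and> norm h \<le> K \<and> norm q \<le> K \<and> norm X \<le> K \<and>
      b \<bullet> X b \<le> f b + f (- b) + \<eta>)"
    using semiconvex_exists_superjet[OF m C \<eta>] by blast
  have "\<exists>h q X. (q, X) \<in> superjet UNIV f (x + h) \<and>
    norm h \<le> K * t \<and> norm (q - p) \<le> K * t \<and> norm X \<le> K \<and>
    b \<bullet> X b \<le> second_difference f x (t *\<^sub>R b) / t\<^sup>2 + \<eta>" if t: "t > 0" for t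
  proof -
    have "\<bar>blowup f x p t h\<bar> \<le> C * (norm h)\<^sup>2" for h
    proof -
      have "\<bar>t\<^sup>2 * blowup f x p t h\<bar> \<le> t\<^sup>2 * (C * (norm h)\<^sup>2)"
        using bound[of "t *\<^sub>R h"] t
        by (simp add: blowup_expansion[of t f x h p] power_mult_distrib mult.left_commute)
      then show ?thesis using t by (simp add: abs_mult)
    qed
    with spec[OF K, of "blowup f x p t"] semiconvex_blowup[OF f t]
    obtain h q X where "(q, X) \<in> superjet UNIV (blowup f x p t) h" "norm h \<le> K" "norm q \<le> K" "norm X \<le> K"
        "b \<bullet> X b \<le> second_difference f x (t *\<^sub>R b) / t\<^sup>2 + \<eta>"
      unfolding blowup_add_blowup_uminus by blast
    then show ?thesis
      using superjet_blowup[of q X f x p t h] t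
      by (intro exI[of _ "t *\<^sub>R h"] exI[of _ "p + t *\<^sub>R q"] exI[of _ X]) (auto simp: mult.commute)
  qed
  then show ?thesis by blast
qed

section \<open>Sup-convolutions\<close>

definition supconv :: "'a::real_inner set \<Rightarrow> real \<Rightarrow> ('a \<Rightarrow> real) \<Rightarrow> 'a \<Rightarrow> real" where
  "supconv R \<epsilon> v \<xi> = (SUP x\<in>R. v x - (norm (x - \<xi>))\<^sup>2 / (2 * \<epsilon>))"

definition supconv_slope :: "'a::real_inner set \<Rightarrow> real \<Rightarrow> ('a \<Rightarrow> real) \<Rightarrow> 'a \<Rightarrow> 'a \<Rightarrow> bool" where
  "supconv_slope R \<epsilon> v \<xi> p \<longleftrightarrow>
    \<xi> + \<epsilon> *\<^sub>R p \<in> R \<and> supconv R \<epsilon> v \<xi> = v (\<xi> + \<epsilon> *\<^sub>R p) - \<epsilon> / 2 * (norm p)\<^sup>2"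

context
  fixes R :: "'a::real_inner set" and \<epsilon> :: real and v :: "'a \<Rightarrow> real"
  assumes R: "compact R" and v: "continuous_on R v" and \<epsilon>: "\<epsilon> > 0"
begin

lemma supconv_upper:
  assumes "x \<in> R"
  shows "v x - (norm (x - \<xi>))\<^sup>2 / (2 * \<epsilon>) \<le> supconv R \<epsilon> v \<xi>"
proof -
  have "bdd_above ((\<lambda>x. v x - (norm (x - \<xi>))\<^sup>2 / (2 * \<epsilon>)) ` R)"
    using \<epsilon>
    by (intro bounded_imp_bdd_above compact_imp_bounded compact_continuous_image R continuous_intros v) auto
  from cSUP_upper[OF assms this] show ?thesis
    by (simp only: supconv_def)
qed

lemma ex_supconv_slope:
  assumes "R \<noteq> {}"
  shows "\<exists>p. supconv_slope R \<epsilon> v \<xi> p"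
proof -
  have "continuous_on R (\<lambda>x. v x - (norm (x - \<xi>))\<^sup>2 / (2 * \<epsilon>))"
    using \<epsilon> by (intro continuous_intros v) auto
  from continuous_attains_sup[OF R assms this]
  obtain x where x: "x \<in> R"
      "\<forall>y\<in>R. v y - (norm (y - \<xi>))\<^sup>2 / (2 * \<epsilon>) \<le> v x - (norm (x - \<xi>))\<^sup>2 / (2 * \<epsilon>)"
    by blast
  then have "supconv R \<epsilon> v \<xi> = v x - (norm (x - \<xi>))\<^sup>2 / (2 * \<epsilon>)"
    unfolding supconv_def by (intro cSup_eq_maximum) auto
  moreover obtain p where p: "x = \<xi> + \<epsilon> *\<^sub>R p"
    using \<epsilon> that[of "(x - \<xi>) /\<^sub>R \<epsilon>"] by simp
  moreover have "(norm (x - \<xi>))\<^sup>2 / (2 * \<epsilon>) = \<epsilon> / 2 * (norm p)\<^sup>2"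
    using \<epsilon> by (simp add: p power_mult_distrib power2_eq_square)
  ultimately have "supconv_slope R \<epsilon> v \<xi> p"
    using x(1) by (simp add: supconv_slope_def)
  then show ?thesis ..
qed

lemma supconv_lower_paraboloid:
  assumes "supconv_slope R \<epsilon> v \<xi> p"
  shows "supconv R \<epsilon> v \<xi> + p \<bullet> h - (norm h)\<^sup>2 / (2 * \<epsilon>) \<le> supconv R \<epsilon> v (\<xi> + h)"
proof -
  have "v (\<xi> + \<epsilon> *\<^sub>R p) - (norm (\<epsilon> *\<^sub>R p - h))\<^sup>2 / (2 * \<epsilon>) \<le> supconv R \<epsilon> v (\<xi> + h)"
    using supconv_upper[of "\<xi> + \<epsilon> *\<^sub>R p" "\<xi> + h"] assms by (simp add: supconv_slope_def)
  moreover have "(norm (\<epsilon> *\<^sub>R p - h))\<^sup>2 / (2 * \<epsilon>) = \<epsilon> / 2 * (norm p)\<^sup>2 - p \<bullet> h + (norm h)\<^sup>2 / (2 * \<epsilon>)"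
    using \<epsilon> unfolding power2_norm_eq_inner
    by (simp add: inner_simps inner_commute power2_eq_square field_simps)
  ultimately show ?thesis
    using assms by (simp add: supconv_slope_def)
qed

lemma semiconvex_supconv:
  assumes "R \<noteq> {}"
  shows "semiconvex (1 / (2 * \<epsilon>)) (supconv R \<epsilon> v)"
  unfolding semiconvex_def
proof safe
  fix t :: real and a b :: 'a assume t: "t \<in> {0..1}"
  let ?c = "(1 - t) *\<^sub>R a + t *\<^sub>R b"
  obtain p where p: "supconv_slope R \<epsilon> v ?c p"
    using ex_supconv_slope[OF assms] by blast
  define x where "x = ?c + \<epsilon> *\<^sub>R p"
  have x: "x \<in> R" "supconv R \<epsilon> v ?c = v x - (norm (x - ?c))\<^sup>2 / (2 * \<epsilon>)"
    using p \<epsilon> by (simp_all add: supconv_slope_def x_def power_mult_distrib power2_eq_square)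
  have "x - ?c = (1 - t) *\<^sub>R (x - a) + t *\<^sub>R (x - b)"
    by (simp add: algebra_simps)
  then have norm_eq: "(norm (x - ?c))\<^sup>2 = (1 - t) * (norm (x - a))\<^sup>2 + t * (norm (x - b))\<^sup>2
      - t * (1 - t) * (norm (a - b))\<^sup>2"
    using norm_convex_combination_sq[of t "x - a" "x - b"] by (simp add: norm_minus_commute[of b a])
  have "supconv R \<epsilon> v ?c = (1 - t) * (v x - (norm (x - a))\<^sup>2 / (2 * \<epsilon>))
      + t * (v x - (norm (x - b))\<^sup>2 / (2 * \<epsilon>)) + 1 / (2 * \<epsilon>) * (t * (1 - t)) * (norm (a - b))\<^sup>2"
    unfolding x(2) norm_eq by (simp add: diff_divide_distrib add_divide_distrib algebra_simps)
  also have "\<dots> \<le> (1 - t) * supconv R \<epsilon> v a + t * supconv R \<epsilon> v b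
      + 1 / (2 * \<epsilon>) * (t * (1 - t)) * (norm (a - b))\<^sup>2"
    using t by (intro add_right_mono add_mono mult_left_mono supconv_upper x(1)) auto
  finally show "supconv R \<epsilon> v ?c \<le> (1 - t) * supconv R \<epsilon> v a + t * supconv R \<epsilon> v b
      + 1 / (2 * \<epsilon>) * (t * (1 - t)) * (norm (a - b))\<^sup>2" .
qed

lemma supconv_slope_eq_superjet:
  assumes slope: "supconv_slope R \<epsilon> v \<xi> p" and jet: "(q, X) \<in> superjet UNIV (supconv R \<epsilon> v) \<xi>"
  shows "q = p"
proof -
  obtain e where X: "self_adjoint X" and e: "e > 0" "\<And>\<zeta>. \<zeta> \<in> UNIV \<Longrightarrow> dist \<xi> \<zeta> < e \<Longrightarrow>
      supconv R \<epsilon> v \<zeta> \<le> supconv R \<epsilon> v \<xi> + quad_poly q X \<xi> \<zeta>"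
    by (rule superjetE[OF jet]) (rule that)
  let ?f = "\<lambda>\<zeta>. quad_poly q X \<xi> \<zeta> - (p \<bullet> (\<zeta> - \<xi>) - (norm (\<zeta> - \<xi>))\<^sup>2 / (2 * \<epsilon>))"
  have "(?f has_derivative (\<lambda>h. (q - p) \<bullet> h)) (at \<xi>)"
    unfolding power2_norm_eq_inner using \<epsilon>
    by (auto intro!: derivative_eq_intros has_derivative_quad_poly[OF X]
        simp: inner_diff_left blinfun.zero_right)
  moreover have "\<forall>\<^sub>F \<zeta> in at \<xi>. ?f \<xi> \<le> ?f \<zeta>"
    unfolding eventually_at
  proof (intro exI[of _ e] conjI ballI impI e(1))
    fix \<zeta> assume "\<zeta> \<noteq> \<xi> \<and> dist \<zeta> \<xi> < e"
    then show "?f \<xi> \<le> ?f \<zeta>"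
      using e(2)[of \<zeta>] supconv_lower_paraboloid[OF slope, of "\<zeta> - \<xi>"] by (simp add: dist_commute)
  qed
  ultimately have "(\<lambda>h. (q - p) \<bullet> h) = (\<lambda>h. 0)"
    by (rule has_derivative_local_min)
  from fun_cong[OF this, of "q - p"] show ?thesis by simp
qed

lemma superjet_supconv_imp_superjet:
  assumes ne: "R \<noteq> {}" and jet: "(p, X) \<in> superjet UNIV (supconv R \<epsilon> v) \<xi>"
  shows "(p, X) \<in> superjet R v (\<xi> + \<epsilon> *\<^sub>R p)"
proof -
  have p: "supconv_slope R \<epsilon> v \<xi> p"
    using ex_supconv_slope[OF ne] supconv_slope_eq_superjet[OF _ jet] by blast
  obtain e where X: "self_adjoint X" and e: "e > 0" "\<And>\<zeta>. \<zeta> \<in> UNIV \<Longrightarrow> dist \<xi> \<zeta> < e \<Longrightarrow>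
      supconv R \<epsilon> v \<zeta> \<le> supconv R \<epsilon> v \<xi> + quad_poly p X \<xi> \<zeta>"
    by (rule superjetE[OF jet]) (rule that)
  show "(p, X) \<in> superjet R v (\<xi> + \<epsilon> *\<^sub>R p)"
  proof (rule superjetI[OF X e(1)])
    fix y assume y: "y \<in> R" "dist (\<xi> + \<epsilon> *\<^sub>R p) y < e"
    have "v y - \<epsilon> / 2 * (norm p)\<^sup>2 \<le> supconv R \<epsilon> v (y - \<epsilon> *\<^sub>R p)"
      using supconv_upper[OF y(1), of "y - \<epsilon> *\<^sub>R p"] \<epsilon>
      by (simp add: power_mult_distrib power2_eq_square mult_ac)
    also have "\<dots> \<le> supconv R \<epsilon> v \<xi> + quad_poly p X \<xi> (y - \<epsilon> *\<^sub>R p)"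
      using y(2) by (intro e(2)) (auto simp: dist_norm algebra_simps)
    also have "quad_poly p X \<xi> (y - \<epsilon> *\<^sub>R p) = quad_poly p X (\<xi> + \<epsilon> *\<^sub>R p) y"
      by (simp add: quad_poly_def diff_diff_add add.commute)
    finally show "v y \<le> v (\<xi> + \<epsilon> *\<^sub>R p) + quad_poly p X (\<xi> + \<epsilon> *\<^sub>R p) y"
      using p by (simp add: supconv_slope_def)
  qed
qed

end

lemma superjet_paraboloidI:
  assumes "\<And>h. f (x + h) \<le> f x + p \<bullet> h + C * (norm h)\<^sup>2"
  shows "(p, (2 * C) *\<^sub>R id_blinfun) \<in> superjet S f x"
proof (rule superjetI[OF _ zero_less_one])
  show "self_adjoint ((2 * C) *\<^sub>R id_blinfun)"
    by (simp add: self_adjoint_def blinfun.scaleR_left)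
  show "f y \<le> f x + quad_poly p ((2 * C) *\<^sub>R id_blinfun) x y" for y
    using assms[of "y - x"] by (simp add: quad_poly_def blinfun.scaleR_left power2_norm_eq_inner add.assoc)
qed

lemma abs_supconv_increment_le:
  fixes R :: "'a::real_inner set"
  assumes R: "compact R" and v: "continuous_on R v" and \<epsilon>: "\<epsilon> > 0" and slope: "supconv_slope R \<epsilon> v \<xi> p"
    and upper: "\<And>h. supconv R \<epsilon> v (\<xi> + h) \<le> supconv R \<epsilon> v \<xi> + p \<bullet> h + C * (norm h)\<^sup>2"
  shows "\<bar>supconv R \<epsilon> v (\<xi> + h) - supconv R \<epsilon> v \<xi> - p \<bullet> h\<bar> \<le> max C (1 / (2 * \<epsilon>)) * (norm h)\<^sup>2"
proof -
  have "C * (norm h)\<^sup>2 \<le> max C (1 / (2 * \<epsilon>)) * (norm h)\<^sup>2"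
    "1 / (2 * \<epsilon>) * (norm h)\<^sup>2 \<le> max C (1 / (2 * \<epsilon>)) * (norm h)\<^sup>2"
    by (intro mult_right_mono; simp)+
  then show ?thesis
    using upper[of h] supconv_lower_paraboloid[OF R v \<epsilon> slope, of h] by (simp add: abs_le_iff)
qed

lemma supconv_superjets_second_difference:
  fixes R :: "'a::euclidean_space set"
  assumes R: "compact R" and v: "continuous_on R v" and \<epsilon>: "\<epsilon> > 0"
    and slope: "supconv_slope R \<epsilon> v \<xi> p" and \<eta>: "\<eta> > 0"
    and upper: "\<And>h. supconv R \<epsilon> v (\<xi> + h) \<le> supconv R \<epsilon> v \<xi> + p \<bullet> h + C * (norm h)\<^sup>2"
  shows "\<exists>K. \<forall>t>0. \<exists>x q X. (q, X) \<in> superjet R v x \<and>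
    norm (x - (\<xi> + \<epsilon> *\<^sub>R p)) \<le> K * t \<and> norm (q - p) \<le> K * t \<and> norm X \<le> K \<and>
    b \<bullet> X b \<le> second_difference (supconv R \<epsilon> v) \<xi> (t *\<^sub>R b) / t\<^sup>2 + \<eta>"
proof -
  let ?u = "supconv R \<epsilon> v"
  have ne: "R \<noteq> {}" using slope by (auto simp: supconv_slope_def)
  have C: "max C (1 / (2 * \<epsilon>)) \<ge> 0" and m: "1 / (2 * \<epsilon>) \<ge> 0"
    using \<epsilon> by (auto simp: le_max_iff_disj)
  from semiconvex_superjets_second_difference[OF semiconvex_supconv[OF R v \<epsilon> ne] m C \<eta>
      abs_supconv_increment_le[OF R v \<epsilon> slope upper], of b]
  obtain K where K: "\<forall>t>0. \<exists>h q X. (q, X) \<in> superjet UNIV ?u (\<xi> + h) \<and>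
      norm h \<le> K * t \<and> norm (q - p) \<le> K * t \<and> norm X \<le> K \<and>
      b \<bullet> X b \<le> second_difference ?u \<xi> (t *\<^sub>R b) / t\<^sup>2 + \<eta>"
    by blast
  have "\<exists>x q X. (q, X) \<in> superjet R v x \<and> norm (x - (\<xi> + \<epsilon> *\<^sub>R p)) \<le> ((1 + \<epsilon>) * K) * t \<and>
      norm (q - p) \<le> ((1 + \<epsilon>) * K) * t \<and> norm X \<le> (1 + \<epsilon>) * K \<and>
      b \<bullet> X b \<le> second_difference ?u \<xi> (t *\<^sub>R b) / t\<^sup>2 + \<eta>" if t: "t > 0" for t
  proof -
    obtain h q X where jet: "(q, X) \<in> superjet UNIV ?u (\<xi> + h)"
      and h: "norm h \<le> K * t" and q: "norm (q - p) \<le> K * t" and X: "norm X \<le> K"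
        "b \<bullet> X b \<le> second_difference ?u \<xi> (t *\<^sub>R b) / t\<^sup>2 + \<eta>"
      using K t by blast
    have "(\<xi> + h + \<epsilon> *\<^sub>R q) - (\<xi> + \<epsilon> *\<^sub>R p) = h + \<epsilon> *\<^sub>R (q - p)"
      by (simp add: algebra_simps)
    also have "norm \<dots> \<le> norm h + \<epsilon> * norm (q - p)"
      by (rule order_trans[OF norm_triangle_ineq]) (use \<epsilon> in simp)
    also have "\<dots> \<le> K * t + \<epsilon> * (K * t)"
      using h q \<epsilon> by (intro add_mono mult_left_mono) auto
    finally have "norm ((\<xi> + h + \<epsilon> *\<^sub>R q) - (\<xi> + \<epsilon> *\<^sub>R p)) \<le> ((1 + \<epsilon>) * K) * t"
      by (simp add: algebra_simps)
    moreover have K_le: "K \<le> (1 + \<epsilon>) * K"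
      using order_trans[OF norm_ge_zero X(1)] \<epsilon> by (simp add: algebra_simps)
    moreover have "norm (q - p) \<le> ((1 + \<epsilon>) * K) * t"
      using q mult_right_mono[OF K_le, of t] t by linarith
    moreover note superjet_supconv_imp_superjet[OF R v \<epsilon> ne jet]
    ultimately show ?thesis
      using X by (meson order_trans)
  qed
  then show ?thesis by blast
qed

lemma tendsto_at_right_0_of_norm_le:
  assumes "\<And>t. t > 0 \<Longrightarrow> norm (f t - l) \<le> K * t"
  shows "(f \<longlongrightarrow> l) (at_right 0)"
proof -
  have "((\<lambda>t. f t - l) \<longlongrightarrow> 0) (at_right 0)"
  proof (rule Lim_null_comparison)
    show "\<forall>\<^sub>F t in at_right 0. norm (f t - l) \<le> K * t"
      by (rule eventually_mono[OF eventually_at_right_less[of 0]]) (rule assms)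
    show "((\<lambda>t. K * t) \<longlongrightarrow> 0) (at_right 0)"
      by (auto intro!: tendsto_eq_intros)
  qed
  then show ?thesis by (simp add: LIM_zero_iff)
qed

lemma abs_quadratic_form_diff_le:
  fixes X :: "'a::real_inner \<Rightarrow>\<^sub>L 'a"
  shows "\<bar>y \<bullet> X y - b \<bullet> X b\<bar> \<le> norm X * norm (y - b) * (norm y + norm b)"
proof -
  have "\<bar>y \<bullet> X y - b \<bullet> X b\<bar> = \<bar>(y - b) \<bullet> X y + b \<bullet> X (y - b)\<bar>"
    by (simp add: inner_simps blinfun.diff_right)
  also have "\<dots> \<le> norm (y - b) * norm (X y) + norm b * norm (X (y - b))"
    by (intro abs_triangle_ineq[THEN order_trans] add_mono Cauchy_Schwarz_ineq2)
  also have "\<dots> \<le> norm (y - b) * (norm X * norm y) + norm b * (norm X * norm (y - b))"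
    by (intro add_mono mult_left_mono norm_blinfun) auto
  finally show ?thesis by (simp add: algebra_simps)
qed

lemma eventually_quadratic_form_ge_limit:
  fixes b :: "'b \<Rightarrow> 'a::real_inner"
  assumes b: "(b \<longlongrightarrow> b0) F" and c: "(c \<longlongrightarrow> c0) F" and \<eta>: "\<eta> > (0::real)"
  shows "\<forall>\<^sub>F t in F. \<forall>X. norm X \<le> K \<and> c t \<le> b t \<bullet> blinfun_apply X (b t) \<longrightarrow>
    c0 \<le> b0 \<bullet> blinfun_apply X b0 + \<eta>"
proof -
  define err where "err = (\<lambda>t. K * norm (b t - b0) * (norm (b t) + norm b0) + (c0 - c t))"
  have "(err \<longlongrightarrow> K * norm (b0 - b0) * (norm b0 + norm b0) + (c0 - c0)) F"
    unfolding err_def by (intro tendsto_intros b c)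
  then have "\<forall>\<^sub>F t in F. err t < \<eta>"
    using \<eta> by (intro order_tendstoD(2)) auto
  then show ?thesis
  proof eventually_elim
    case (elim t)
    show ?case
    proof safe
      fix X :: "'a \<Rightarrow>\<^sub>L 'a" assume X: "norm X \<le> K" and le: "c t \<le> b t \<bullet> X (b t)"
      have "b t \<bullet> X (b t) \<le> b0 \<bullet> X b0 + norm X * norm (b t - b0) * (norm (b t) + norm b0)"
        using abs_quadratic_form_diff_le[of "b t" X b0] by linarith
      also have "\<dots> \<le> b0 \<bullet> X b0 + K * norm (b t - b0) * (norm (b t) + norm b0)"
        using X by (intro add_left_mono mult_right_mono) auto
      finally show "c0 \<le> b0 \<bullet> X b0 + \<eta>"
        using le elim by (simp add: err_def)
    qed
  qed
qed

lemma supconv_superjet_family: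
  fixes R :: "'a::euclidean_space set"
  assumes R: "compact R" and v: "continuous_on R v" and \<epsilon>: "\<epsilon> > 0"
    and slope: "supconv_slope R \<epsilon> v \<xi> p" and \<eta>: "\<eta> > 0"
    and upper: "\<And>h. supconv R \<epsilon> v (\<xi> + h) \<le> supconv R \<epsilon> v \<xi> + p \<bullet> h + C * (norm h)\<^sup>2"
  obtains x q X K where "(x \<longlongrightarrow> \<xi> + \<epsilon> *\<^sub>R p) (at_right 0)" "(q \<longlongrightarrow> p) (at_right 0)"
    "\<And>t. t > 0 \<Longrightarrow> (q t, X t) \<in> superjet R v (x t)" "\<And>t. t > 0 \<Longrightarrow> norm (X t) \<le> K"
    "\<And>t. t > 0 \<Longrightarrow> b \<bullet> X t b \<le> second_difference (supconv R \<epsilon> v) \<xi> (t *\<^sub>R b) / t\<^sup>2 + \<eta>"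
proof -
  let ?S = "\<lambda>t. second_difference (supconv R \<epsilon> v) \<xi> (t *\<^sub>R b) / t\<^sup>2"
  obtain K where "\<forall>t>0. \<exists>x q X. (q, X) \<in> superjet R v x \<and> norm (x - (\<xi> + \<epsilon> *\<^sub>R p)) \<le> K * t \<and>
      norm (q - p) \<le> K * t \<and> norm X \<le> K \<and> b \<bullet> X b \<le> ?S t + \<eta>"
    using supconv_superjets_second_difference[OF R v \<epsilon> slope \<eta> upper, of b] by blast
  then obtain x q X where jet: "\<And>t. t > 0 \<Longrightarrow> (q t, X t) \<in> superjet R v (x t)"
    and x: "\<And>t. t > 0 \<Longrightarrow> norm (x t - (\<xi> + \<epsilon> *\<^sub>R p)) \<le> K * t"
    and q: "\<And>t. t > 0 \<Longrightarrow> norm (q t - p) \<le> K * t"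
    and X: "\<And>t. t > 0 \<Longrightarrow> norm (X t) \<le> K" "\<And>t. t > 0 \<Longrightarrow> b \<bullet> X t b \<le> ?S t + \<eta>"
    by metis
  from that[OF tendsto_at_right_0_of_norm_le[OF x] tendsto_at_right_0_of_norm_le[OF q] jet X]
  show ?thesis .
qed

lemma jet_subsolution_second_difference_ge:
  fixes R :: "'a::euclidean_space set"
  assumes R: "compact R" and v: "continuous_on R v" and \<epsilon>: "\<epsilon> > 0"
    and slope: "supconv_slope R \<epsilon> v \<xi> p" and x: "\<xi> + \<epsilon> *\<^sub>R p \<in> interior R"
    and upper: "\<And>h. supconv R \<epsilon> v (\<xi> + h) \<le> supconv R \<epsilon> v \<xi> + p \<bullet> h + C * (norm h)\<^sup>2"
    and \<beta>: "continuous_on (interior R \<times> UNIV) \<beta>" and \<gamma>: "continuous_on (interior R \<times> UNIV) \<gamma>"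
    and sub: "jet_subsolution (interior R) \<beta> \<gamma> v"
    and b: "b = \<beta> (\<xi> + \<epsilon> *\<^sub>R p, p)" and \<eta>: "\<eta> > 0"
  shows "\<forall>\<^sub>F t in at_right 0. \<gamma> (\<xi> + \<epsilon> *\<^sub>R p, p) \<le> second_difference (supconv R \<epsilon> v) \<xi> (t *\<^sub>R b) / t\<^sup>2 + \<eta>"
proof -
  define z where "z = (\<xi> + \<epsilon> *\<^sub>R p, p)"
  obtain x q X K where x_lim: "(x \<longlongrightarrow> \<xi> + \<epsilon> *\<^sub>R p) (at_right 0)" and q_lim: "(q \<longlongrightarrow> p) (at_right 0)"
    and jet: "\<And>t. t > 0 \<Longrightarrow> (q t, X t) \<in> superjet R v (x t)" and X: "\<And>t. t > 0 \<Longrightarrow> norm (X t) \<le> K"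
      "\<And>t. t > 0 \<Longrightarrow> b \<bullet> X t b \<le> second_difference (supconv R \<epsilon> v) \<xi> (t *\<^sub>R b) / t\<^sup>2 + \<eta> / 2"
    by (rule supconv_superjet_family[OF R v \<epsilon> slope half_gt_zero[OF \<eta>] upper, of b]) (rule that)
  define w where "w = (\<lambda>t. (x t, q t))"
  have w: "(w \<longlongrightarrow> z) (at_right 0)"
    unfolding w_def z_def by (intro tendsto_Pair x_lim q_lim)
  have "z \<in> interior R \<times> UNIV" "open (interior R \<times> (UNIV :: 'a set))"
    using x by (auto simp: z_def intro!: open_Times)
  then have "isCont \<beta> z" "isCont \<gamma> z"
    using \<beta> \<gamma> by (auto simp: continuous_on_eq_continuous_at)
  then have "((\<lambda>t. \<beta> (w t)) \<longlongrightarrow> b) (at_right 0)" "((\<lambda>t. \<gamma> (w t)) \<longlongrightarrow> \<gamma> z) (at_right 0)"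
    unfolding b z_def[symmetric] by (auto intro: isCont_tendsto_compose[OF _ w])
  from eventually_quadratic_form_ge_limit[OF this half_gt_zero[OF \<eta>], of K]
  have "\<forall>\<^sub>F t in at_right 0. \<forall>X. norm X \<le> K \<and> \<gamma> (w t) \<le> \<beta> (w t) \<bullet> blinfun_apply X (\<beta> (w t)) \<longrightarrow>
      \<gamma> z \<le> b \<bullet> blinfun_apply X b + \<eta> / 2" .
  moreover have "\<forall>\<^sub>F t in at_right 0. x t \<in> interior R"
    using x by (intro topological_tendstoD[OF x_lim]) auto
  moreover have "\<forall>\<^sub>F t::real in at_right 0. t > 0"
    by (rule eventually_at_right_less)
  ultimately show ?thesis
  proof eventually_elim
    case (elim t)
    have "\<gamma> (w t) \<le> \<beta> (w t) \<bullet> X t (\<beta> (w t))"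
      using superjet_interior_subset[OF elim(2), of v "interior R"] jet[OF elim(3)] elim(2)
      unfolding w_def by (intro jet_subsolutionD[OF sub]) auto
    then have "\<gamma> z \<le> b \<bullet> X t b + \<eta> / 2"
      using elim(1) X(1)[OF elim(3)] by blast
    then show ?case
      using X(2)[OF elim(3)] by (simp add: z_def)
  qed
qed

section \<open>Doubling of variables\<close>

definition doubled :: "real \<Rightarrow> real \<Rightarrow> 'a::real_inner \<Rightarrow> ('a \<Rightarrow> real) \<Rightarrow> ('a \<Rightarrow> real) \<Rightarrow> 'a \<Rightarrow> 'a \<Rightarrow> real" where
  "doubled \<epsilon> \<mu> x0 U V \<xi> \<zeta> =
    U \<xi> + V \<zeta> - (norm (\<xi> - \<zeta>))\<^sup>2 / (2 * \<epsilon>) - \<mu> * (norm (\<xi> - x0))\<^sup>2"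

lemma doubled_max_increment:
  assumes max: "\<And>\<xi>' \<zeta>'. doubled \<epsilon> \<mu> x0 U V \<xi>' \<zeta>' \<le> doubled \<epsilon> \<mu> x0 U V \<xi> \<zeta>" and \<epsilon>: "\<epsilon> > 0"
    and d: "d = (\<xi> - \<zeta>) /\<^sub>R \<epsilon>"
  shows "U (\<xi> + h) + V (\<zeta> + k) \<le> U \<xi> + V \<zeta> + (d + (2 * \<mu>) *\<^sub>R (\<xi> - x0)) \<bullet> h - d \<bullet> k
    + (norm (h - k))\<^sup>2 / (2 * \<epsilon>) + \<mu> * (norm h)\<^sup>2"
proof -
  have norm_add_sq: "(norm (a + k))\<^sup>2 = (norm a)\<^sup>2 + 2 * (a \<bullet> k) + (norm k)\<^sup>2" for a k :: 'a
    by (simp add: power2_norm_eq_inner inner_simps inner_commute)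
  have "\<xi> + h - (\<zeta> + k) = (\<xi> - \<zeta>) + (h - k)" by simp
  moreover have "(\<xi> - \<zeta>) \<bullet> (h - k) = \<epsilon> * (d \<bullet> (h - k))"
    using \<epsilon> by (simp add: d)
  ultimately have "(norm (\<xi> + h - (\<zeta> + k)))\<^sup>2 / (2 * \<epsilon>) =
      (norm (\<xi> - \<zeta>))\<^sup>2 / (2 * \<epsilon>) + d \<bullet> (h - k) + (norm (h - k))\<^sup>2 / (2 * \<epsilon>)"
    using \<epsilon> by (simp only: norm_add_sq) (simp add: add_divide_distrib)
  moreover have "(norm (\<xi> + h - x0))\<^sup>2 = (norm (\<xi> - x0))\<^sup>2 + 2 * ((\<xi> - x0) \<bullet> h) + (norm h)\<^sup>2"
    using norm_add_sq[of "\<xi> - x0" h] by (simp add: algebra_simps)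
  ultimately show ?thesis
    using max[of "\<xi> + h" "\<zeta> + k"]
    by (simp add: doubled_def inner_add_left inner_diff_right[of d] distrib_left)
qed

lemma doubled_max_second_difference:
  assumes max: "\<And>\<xi>' \<zeta>'. doubled \<epsilon> \<mu> x0 U V \<xi>' \<zeta>' \<le> doubled \<epsilon> \<mu> x0 U V \<xi> \<zeta>" and \<epsilon>: "\<epsilon> > 0"
  shows "second_difference U \<xi> h + second_difference V \<zeta> k \<le> (norm (h - k))\<^sup>2 / \<epsilon> + 2 * \<mu> * (norm h)\<^sup>2"
proof -
  have "norm (- h - - k) = norm (h - k)" by (simp add: norm_minus_commute)
  then show ?thesis
    using doubled_max_increment[OF max \<epsilon> refl, of h k] doubled_max_increment[OF max \<epsilon> refl, of "- h" "- k"]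
    by (simp add: second_difference_def)
qed

lemma sum_le_of_sum_squares_le:
  fixes a b d M :: real
  assumes "a \<ge> 0" "b \<ge> 0" "d \<ge> 0" "M \<ge> 0" "a\<^sup>2 + b\<^sup>2 + d\<^sup>2 \<le> M * (a + b + d)"
  shows "a + b + d \<le> 3 * M"
proof -
  have "3 * (a\<^sup>2 + b\<^sup>2 + d\<^sup>2) - (a + b + d)\<^sup>2 = (a - b)\<^sup>2 + (b - d)\<^sup>2 + (a - d)\<^sup>2"
    by (simp add: power2_eq_square algebra_simps)
  also have "\<dots> \<ge> 0" by simp
  finally have "(a + b + d)\<^sup>2 \<le> (3 * M) * (a + b + d)"
    using assms(5) by simp
  then have "(a + b + d) * (a + b + d) \<le> (3 * M) * (a + b + d)"
    by (simp only: power2_eq_square)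
  then show ?thesis
    using assms by (cases "a + b + d = 0") (auto simp: mult_le_cancel_right)
qed

lemma doubling_estimates:
  assumes \<epsilon>: "\<epsilon> > 0" and \<mu>: "\<mu> \<ge> 0" and lip: "L-lipschitz_on R u"
    and p: "supconv_slope R \<epsilon> u \<xi> p" and q: "supconv_slope R \<epsilon> (\<lambda>x. - u x) \<zeta> q"
    and ge: "0 \<le> doubled \<epsilon> \<mu> x0 (supconv R \<epsilon> u) (supconv R \<epsilon> (\<lambda>x. - u x)) \<xi> \<zeta>"
  shows "norm p \<le> 6 * L" "norm q \<le> 6 * L" "norm ((\<xi> + \<epsilon> *\<^sub>R p) - (\<zeta> + \<epsilon> *\<^sub>R q)) \<le> 6 * L * \<epsilon>"
    "\<mu> * (norm (\<xi> - x0))\<^sup>2 \<le> 6 * L\<^sup>2 * \<epsilon>"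
proof -
  have L: "L \<ge> 0" using lip by (rule lipschitz_on_nonneg)
  define a b d where "a = \<epsilon> * norm p" and "b = norm (\<xi> - \<zeta>)" and "d = \<epsilon> * norm q"
  define s where "s = a + b + d"
  let ?x = "\<xi> + \<epsilon> *\<^sub>R p" and ?y = "\<zeta> + \<epsilon> *\<^sub>R q"
  have pos: "a \<ge> 0" "b \<ge> 0" "d \<ge> 0" using \<epsilon> by (auto simp: a_def b_def d_def)
  have "?x - ?y = \<epsilon> *\<^sub>R p + (\<xi> - \<zeta>) - \<epsilon> *\<^sub>R q" by simp
  also have "norm \<dots> \<le> norm (\<epsilon> *\<^sub>R p) + norm (\<xi> - \<zeta>) + norm (\<epsilon> *\<^sub>R q)"
    by (meson norm_triangle_ineq4 norm_triangle_ineq add_right_mono order_trans)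
  finally have xy: "norm (?x - ?y) \<le> s"
    using \<epsilon> by (simp add: s_def a_def b_def d_def)
  have "u ?x - u ?y \<le> L * norm (?x - ?y)"
    using lipschitz_on_normD[OF lip, of ?x ?y] p q by (simp add: supconv_slope_def)
  also have "\<dots> \<le> L * s" using xy L by (rule mult_left_mono)
  finally have sum: "a\<^sup>2 / (2 * \<epsilon>) + b\<^sup>2 / (2 * \<epsilon>) + d\<^sup>2 / (2 * \<epsilon>) + \<mu> * (norm (\<xi> - x0))\<^sup>2 \<le> L * s"
    using ge p q \<epsilon>
    by (simp add: doubled_def supconv_slope_def a_def b_def d_def power_mult_distrib power2_eq_square mult_ac)
  have nonneg: "0 \<le> a\<^sup>2 / (2 * \<epsilon>)" "0 \<le> b\<^sup>2 / (2 * \<epsilon>)" "0 \<le> d\<^sup>2 / (2 * \<epsilon>)" "0 \<le> \<mu> * (norm (\<xi> - x0))\<^sup>2"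
    using \<epsilon> \<mu> by auto
  have "a\<^sup>2 / (2 * \<epsilon>) + b\<^sup>2 / (2 * \<epsilon>) + d\<^sup>2 / (2 * \<epsilon>) \<le> L * s"
    using sum nonneg by linarith
  then have "a\<^sup>2 + b\<^sup>2 + d\<^sup>2 \<le> 2 * \<epsilon> * L * s"
    using \<epsilon> by (simp add: field_simps)
  also have "\<dots> = (2 * L * \<epsilon>) * s" by simp
  finally have s: "s \<le> 6 * L * \<epsilon>"
    using sum_le_of_sum_squares_le[of a b d "2 * L * \<epsilon>"] pos L \<epsilon> by (simp add: s_def)
  have "\<epsilon> * norm p \<le> \<epsilon> * (6 * L)" "\<epsilon> * norm q \<le> \<epsilon> * (6 * L)"
    using s pos by (auto simp: s_def a_def d_def mult.commute[of \<epsilon>])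
  then show "norm p \<le> 6 * L" "norm q \<le> 6 * L" using \<epsilon> by auto
  show "norm (?x - ?y) \<le> 6 * L * \<epsilon>" using xy s by simp
  have "\<mu> * (norm (\<xi> - x0))\<^sup>2 \<le> L * s" using sum nonneg by linarith
  also have "\<dots> \<le> L * (6 * L * \<epsilon>)" using s L by (rule mult_left_mono)
  finally show "\<mu> * (norm (\<xi> - x0))\<^sup>2 \<le> 6 * L\<^sup>2 * \<epsilon>" by (simp add: power2_eq_square mult_ac)
qed

lemma exists_doubled_supconv_max:
  fixes u :: "'a::euclidean_space \<Rightarrow> real"
  assumes \<epsilon>: "\<epsilon> > 0" and \<mu>: "\<mu> \<ge> 0" and R: "compact R" "x0 \<in> R" and lip: "L-lipschitz_on R u"
  defines "w \<equiv> doubled \<epsilon> \<mu> x0 (supconv R \<epsilon> u) (supconv R \<epsilon> (\<lambda>x. - u x))"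
  obtains \<xi> \<zeta> where "\<And>\<xi>' \<zeta>'. w \<xi>' \<zeta>' \<le> w \<xi> \<zeta>" "0 \<le> w \<xi> \<zeta>"
proof -
  have ne: "R \<noteq> {}" using R by blast
  have u: "continuous_on R u" using lip by (rule lipschitz_on_continuous_on)
  have u': "continuous_on R (\<lambda>x. - u x)" by (intro continuous_intros u)
  define T where "T = {a - b |a b. a \<in> R \<and> b \<in> cball 0 (6 * L * \<epsilon>)}"
  have "compact T" unfolding T_def by (intro compact_differences R compact_cball)
  have T: "\<xi> \<in> T" if "supconv_slope R \<epsilon> v \<xi> p" "norm p \<le> 6 * L" for v \<xi> p
    using that \<epsilon> unfolding T_def supconv_slope_def
    by (intro CollectI exI[of _ "\<xi> + \<epsilon> *\<^sub>R p"] exI[of _ "\<epsilon> *\<^sub>R p"]) auto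
  have in_T: "\<xi> \<in> T" "\<zeta> \<in> T" if "0 \<le> w \<xi> \<zeta>" for \<xi> \<zeta>
  proof -
    obtain p q where "supconv_slope R \<epsilon> u \<xi> p" "supconv_slope R \<epsilon> (\<lambda>x. - u x) \<zeta> q"
      using ex_supconv_slope[OF R(1) u \<epsilon> ne] ex_supconv_slope[OF R(1) u' \<epsilon> ne] by blast
    with doubling_estimates(1,2)[OF \<epsilon> \<mu> lip this that[unfolded w_def]] T
    show "\<xi> \<in> T" "\<zeta> \<in> T" by blast+
  qed
  have "u x0 \<le> supconv R \<epsilon> u x0" "- u x0 \<le> supconv R \<epsilon> (\<lambda>x. - u x) x0"
    using supconv_upper[OF R(1) u \<epsilon> R(2), of x0] supconv_upper[OF R(1) u' \<epsilon> R(2), of x0] by auto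
  then have x0: "0 \<le> w x0 x0" by (simp add: w_def doubled_def)
  have "continuous_on (T \<times> T) (\<lambda>z. w (fst z) (snd z))"
    unfolding w_def doubled_def using \<epsilon>
    by (intro continuous_intros R u u' ne subset_UNIV
        semiconvex_imp_continuous_on[THEN continuous_on_compose2, OF semiconvex_supconv]) auto
  moreover have "compact (T \<times> T)" "T \<times> T \<noteq> {}"
    using \<open>compact T\<close> in_T[OF x0] by (auto simp: compact_Times)
  ultimately obtain z where z: "\<forall>z'\<in>T \<times> T. w (fst z') (snd z') \<le> w (fst z) (snd z)"
    using continuous_attains_sup by blast
  have z0: "0 \<le> w (fst z) (snd z)"
    using z in_T[OF x0] x0 by force
  moreover have "w \<xi>' \<zeta>' \<le> w (fst z) (snd z)" for \<xi>' \<zeta>'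
    using z in_T[of \<xi>' \<zeta>'] z0 by (cases "0 \<le> w \<xi>' \<zeta>'") force+
  ultimately show ?thesis using that by blast
qed

lemma doubling_points:
  fixes u :: "'a::euclidean_space \<Rightarrow> real"
  assumes \<epsilon>: "\<epsilon> > 0" and \<mu>: "\<mu> \<ge> 0" and R: "compact R" "x0 \<in> R" and lip: "L-lipschitz_on R u"
  defines "U \<equiv> supconv R \<epsilon> u" and "V \<equiv> supconv R \<epsilon> (\<lambda>x. - u x)"
  obtains \<xi> \<zeta> p q where "supconv_slope R \<epsilon> u \<xi> p" "supconv_slope R \<epsilon> (\<lambda>x. - u x) \<zeta> q"
    "0 \<le> doubled \<epsilon> \<mu> x0 U V \<xi> \<zeta>" "p + q = (2 * \<mu>) *\<^sub>R (\<xi> - x0)"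
    "\<And>h. U (\<xi> + h) \<le> U \<xi> + p \<bullet> h + (1 / (2 * \<epsilon>) + \<mu>) * (norm h)\<^sup>2"
    "\<And>k. V (\<zeta> + k) \<le> V \<zeta> + q \<bullet> k + 1 / (2 * \<epsilon>) * (norm k)\<^sup>2"
    "\<And>h k. second_difference U \<xi> h + second_difference V \<zeta> k \<le> (norm (h - k))\<^sup>2 / \<epsilon> + 2 * \<mu> * (norm h)\<^sup>2"
proof -
  have ne: "R \<noteq> {}" using R by blast
  have u: "continuous_on R u" using lip by (rule lipschitz_on_continuous_on)
  have u': "continuous_on R (\<lambda>x. - u x)" by (intro continuous_intros u)
  obtain \<xi> \<zeta> where max: "\<And>\<xi>' \<zeta>'. doubled \<epsilon> \<mu> x0 U V \<xi>' \<zeta>' \<le> doubled \<epsilon> \<mu> x0 U V \<xi> \<zeta>"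
      and ge: "0 \<le> doubled \<epsilon> \<mu> x0 U V \<xi> \<zeta>"
    by (rule exists_doubled_supconv_max[OF \<epsilon> \<mu> R lip, folded U_def V_def]) (rule that)
  obtain p q where p: "supconv_slope R \<epsilon> u \<xi> p" and q: "supconv_slope R \<epsilon> (\<lambda>x. - u x) \<zeta> q"
    using ex_supconv_slope[OF R(1) u \<epsilon> ne] ex_supconv_slope[OF R(1) u' \<epsilon> ne] by blast
  define d where "d = (\<xi> - \<zeta>) /\<^sub>R \<epsilon>"
  note increment = doubled_max_increment[OF max \<epsilon> d_def]
  have upper_U: "U (\<xi> + h) \<le> U \<xi> + (d + (2 * \<mu>) *\<^sub>R (\<xi> - x0)) \<bullet> h + (1 / (2 * \<epsilon>) + \<mu>) * (norm h)\<^sup>2" for h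
    using increment[of h 0] by (simp add: distrib_right)
  have upper_V: "V (\<zeta> + k) \<le> V \<zeta> + (- d) \<bullet> k + 1 / (2 * \<epsilon>) * (norm k)\<^sup>2" for k
    using increment[of 0 k] by simp
  have p_eq: "d + (2 * \<mu>) *\<^sub>R (\<xi> - x0) = p"
    using supconv_slope_eq_superjet[OF R(1) u \<epsilon> p] superjet_paraboloidI[OF upper_U] unfolding U_def by blast
  moreover have q_eq: "- d = q"
    using supconv_slope_eq_superjet[OF R(1) u' \<epsilon> q] superjet_paraboloidI[OF upper_V] unfolding V_def by blast
  ultimately have "p + q = (2 * \<mu>) *\<^sub>R (\<xi> - x0)" by auto
  from that[OF p q ge this upper_U[unfolded p_eq] upper_V[unfolded q_eq]
      doubled_max_second_difference[OF max \<epsilon>]]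
  show ?thesis .
qed

lemma doubling_points_in_ball:
  fixes \<xi> \<zeta> p q :: "'a::real_inner"
  assumes \<epsilon>: "\<epsilon> > 0" and \<mu>: "\<mu> \<ge> 0" and r: "r > 0" and p: "norm p \<le> 6 * L"
    and dist: "norm ((\<xi> + \<epsilon> *\<^sub>R p) - (\<zeta> + \<epsilon> *\<^sub>R q)) \<le> 6 * L * \<epsilon>"
    and penalty: "\<mu> * (norm (\<xi> - x0))\<^sup>2 \<le> 6 * L\<^sup>2 * \<epsilon>"
    and small: "24 * L * \<epsilon> < r" "24 * L\<^sup>2 * \<epsilon> < \<mu> * r\<^sup>2"
  shows "norm (\<xi> - x0) < r / 2" "\<xi> + \<epsilon> *\<^sub>R p \<in> ball x0 r" "\<zeta> + \<epsilon> *\<^sub>R q \<in> ball x0 r"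
proof -
  define x y where "x = \<xi> + \<epsilon> *\<^sub>R p" and "y = \<zeta> + \<epsilon> *\<^sub>R q"
  show \<xi>: "norm (\<xi> - x0) < r / 2"
  proof (rule ccontr)
    assume "\<not> ?thesis"
    then have "(r / 2)\<^sup>2 \<le> (norm (\<xi> - x0))\<^sup>2" using r by (intro power_mono) auto
    then have "\<mu> * (r / 2)\<^sup>2 \<le> 6 * L\<^sup>2 * \<epsilon>" using penalty \<mu> by (meson mult_left_mono order_trans)
    then show False using small(2) by (simp add: power_divide)
  qed
  have "norm (x - \<xi>) \<le> 6 * L * \<epsilon>"
    using p \<epsilon> by (simp add: x_def mult.commute)
  moreover have "norm (x - x0) \<le> norm (x - \<xi>) + norm (\<xi> - x0)" "norm (y - x0) \<le> norm (x - y) + norm (x - x0)"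
    using norm_triangle_ineq[of "x - \<xi>" "\<xi> - x0"] norm_triangle_ineq[of "y - x" "x - x0"]
    by (simp_all add: norm_minus_commute)
  ultimately have "norm (x - x0) < r" "norm (y - x0) < r"
    using \<xi> dist[folded x_def y_def] small(1) r by linarith+
  then show "\<xi> + \<epsilon> *\<^sub>R p \<in> ball x0 r" "\<zeta> + \<epsilon> *\<^sub>R q \<in> ball x0 r"
    unfolding x_def y_def by (simp_all add: dist_norm norm_minus_commute)
qed

lemma add_le_of_second_differences:
  assumes U: "\<And>\<eta>. \<eta> > 0 \<Longrightarrow> \<forall>\<^sub>F t in at_right 0. A \<le> second_difference U \<xi> (t *\<^sub>R b) / t\<^sup>2 + \<eta>"
    and V: "\<And>\<eta>. \<eta> > 0 \<Longrightarrow> \<forall>\<^sub>F t in at_right 0. A' \<le> second_difference V \<zeta> (t *\<^sub>R b') / t\<^sup>2 + \<eta>"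
    and diff: "\<And>h k. second_difference U \<xi> h + second_difference V \<zeta> k
      \<le> (norm (h - k))\<^sup>2 / \<epsilon> + 2 * \<mu> * (norm h)\<^sup>2"
  shows "A + A' \<le> (norm (b - b'))\<^sup>2 / \<epsilon> + 2 * \<mu> * (norm b)\<^sup>2"
proof (rule field_le_epsilon)
  fix \<eta> :: real assume "\<eta> > 0"
  then have \<eta>: "\<eta> / 2 > 0" by simp
  have "\<forall>\<^sub>F t::real in at_right 0. t > 0"
    by (rule eventually_at_right_less)
  with U[OF \<eta>] V[OF \<eta>]
  have "\<forall>\<^sub>F t::real in at_right 0. A + A' \<le> (norm (b - b'))\<^sup>2 / \<epsilon> + 2 * \<mu> * (norm b)\<^sup>2 + \<eta>"
  proof eventually_elim
    case (elim t)
    have "second_difference U \<xi> (t *\<^sub>R b) + second_difference V \<zeta> (t *\<^sub>R b')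
        \<le> t\<^sup>2 * ((norm (b - b'))\<^sup>2 / \<epsilon> + 2 * \<mu> * (norm b)\<^sup>2)"
      using diff[of "t *\<^sub>R b" "t *\<^sub>R b'"]
      by (simp add: scaleR_diff_right[symmetric] power_mult_distrib distrib_left mult_ac)
    then have "second_difference U \<xi> (t *\<^sub>R b) / t\<^sup>2 + second_difference V \<zeta> (t *\<^sub>R b') / t\<^sup>2
        \<le> (norm (b - b'))\<^sup>2 / \<epsilon> + 2 * \<mu> * (norm b)\<^sup>2"
      using elim(3) by (simp add: add_divide_distrib[symmetric] pos_divide_le_eq mult.commute)
    then show ?case using elim(1,2) by simp
  qed
  then show "A + A' \<le> (norm (b - b'))\<^sup>2 / \<epsilon> + 2 * \<mu> * (norm b)\<^sup>2 + \<eta>"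
    by simp
qed

lemma doubling_inequality:
  fixes u :: "'a::euclidean_space \<Rightarrow> real"
  assumes \<epsilon>: "\<epsilon> > 0" and \<mu>: "\<mu> \<ge> 0" and r: "r > 0" and lip: "L-lipschitz_on (cball x0 r) u"
    and \<beta>: "continuous_on (ball x0 r \<times> UNIV) \<beta>" and \<gamma>: "continuous_on (ball x0 r \<times> UNIV) \<gamma>"
    and \<beta>': "continuous_on (ball x0 r \<times> UNIV) \<beta>'" and \<gamma>': "continuous_on (ball x0 r \<times> UNIV) \<gamma>'"
    and sub: "jet_subsolution (ball x0 r) \<beta> \<gamma> u"
    and super: "jet_subsolution (ball x0 r) \<beta>' \<gamma>' (\<lambda>x. - u x)"
    and small: "24 * L * \<epsilon> < r" "24 * L\<^sup>2 * \<epsilon> < \<mu> * r\<^sup>2"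
  obtains x y p q where "x \<in> cball x0 r" "y \<in> cball x0 r" "norm (x - y) \<le> 6 * L * \<epsilon>"
    "norm p \<le> 6 * L" "norm q \<le> 6 * L" "norm (p + q) \<le> 2 * \<mu> * r"
    "\<gamma> (x, p) + \<gamma>' (y, q) \<le> (norm (\<beta> (x, p) - \<beta>' (y, q)))\<^sup>2 / \<epsilon> + 2 * \<mu> * (norm (\<beta> (x, p)))\<^sup>2"
proof -
  let ?R = "cball x0 r"
  let ?U = "supconv ?R \<epsilon> u" and ?V = "supconv ?R \<epsilon> (\<lambda>x. - u x)"
  have R: "compact ?R" "x0 \<in> ?R" and int: "interior ?R = ball x0 r" using r by auto
  have u: "continuous_on ?R u" using lip by (rule lipschitz_on_continuous_on)
  have u': "continuous_on ?R (\<lambda>x. - u x)" by (intro continuous_intros u)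
  obtain \<xi> \<zeta> p q where p: "supconv_slope ?R \<epsilon> u \<xi> p" and q: "supconv_slope ?R \<epsilon> (\<lambda>x. - u x) \<zeta> q"
      and ge: "0 \<le> doubled \<epsilon> \<mu> x0 ?U ?V \<xi> \<zeta>" and sum: "p + q = (2 * \<mu>) *\<^sub>R (\<xi> - x0)"
      and upper_U: "\<And>h. ?U (\<xi> + h) \<le> ?U \<xi> + p \<bullet> h + (1 / (2 * \<epsilon>) + \<mu>) * (norm h)\<^sup>2"
      and upper_V: "\<And>k. ?V (\<zeta> + k) \<le> ?V \<zeta> + q \<bullet> k + 1 / (2 * \<epsilon>) * (norm k)\<^sup>2"
      and diff: "\<And>h k. second_difference ?U \<xi> h + second_difference ?V \<zeta> k
        \<le> (norm (h - k))\<^sup>2 / \<epsilon> + 2 * \<mu> * (norm h)\<^sup>2"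
    by (rule doubling_points[OF \<epsilon> \<mu> R lip]) (rule that)
  define x y where "x = \<xi> + \<epsilon> *\<^sub>R p" and "y = \<zeta> + \<epsilon> *\<^sub>R q"
  note est = doubling_estimates[OF \<epsilon> \<mu> lip p q ge, folded x_def y_def]
  have \<xi>: "norm (\<xi> - x0) < r / 2" and x: "x \<in> ball x0 r" and y: "y \<in> ball x0 r"
    using doubling_points_in_ball[OF \<epsilon> \<mu> r est(1) est(3,4)[unfolded x_def y_def] small]
    unfolding x_def y_def by auto
  define b b' where "b = \<beta> (x, p)" and "b' = \<beta>' (y, q)"
  have "\<gamma> (x, p) + \<gamma>' (y, q) \<le> (norm (b - b'))\<^sup>2 / \<epsilon> + 2 * \<mu> * (norm b)\<^sup>2"
  proof (rule add_le_of_second_differences[OF _ _ diff])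
    fix \<eta> :: real assume \<eta>: "\<eta> > 0"
    show "\<forall>\<^sub>F t in at_right 0. \<gamma> (x, p) \<le> second_difference ?U \<xi> (t *\<^sub>R b) / t\<^sup>2 + \<eta>"
      unfolding x_def using x \<beta> \<gamma> sub \<eta>
      by (intro jet_subsolution_second_difference_ge[OF R(1) u \<epsilon> p _ upper_U])
        (simp_all add: int x_def b_def)
    show "\<forall>\<^sub>F t in at_right 0. \<gamma>' (y, q) \<le> second_difference ?V \<zeta> (t *\<^sub>R b') / t\<^sup>2 + \<eta>"
      unfolding y_def using y \<beta>' \<gamma>' super \<eta>
      by (intro jet_subsolution_second_difference_ge[OF R(1) u' \<epsilon> q _ upper_V])
        (simp_all add: int y_def b'_def)
  qed
  moreover have "norm (p + q) \<le> 2 * \<mu> * r"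
    using \<xi> \<mu> r unfolding sum by (auto intro!: mult_left_mono)
  ultimately show ?thesis
    using that[of x y p q] est x y by (simp add: b_def b'_def)
qed

lemma compact_near_diagonal_le:
  fixes f g :: "'a::metric_space \<Rightarrow> real"
  assumes Q: "compact Q" and f: "continuous_on Q f" and g: "continuous_on Q g"
    and near: "\<And>\<delta>. \<delta> > 0 \<Longrightarrow> \<exists>z\<in>Q. \<exists>z'\<in>Q. dist z z' \<le> \<delta> \<and> f z \<le> g z' + \<delta>"
  shows "\<exists>z\<in>Q. f z \<le> g z"
proof (rule ccontr)
  assume "\<not> ?thesis"
  then have less: "f z - g z > 0" if "z \<in> Q" for z using that by force
  have "Q \<noteq> {}" using near[of 1] by auto
  moreover have "continuous_on Q (\<lambda>z. f z - g z)" by (intro continuous_intros f g)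
  ultimately obtain z0 where z0: "z0 \<in> Q" "\<forall>z\<in>Q. f z0 - g z0 \<le> f z - g z"
    using continuous_attains_inf[OF Q] by blast
  define m where "m = (f z0 - g z0) / 2"
  have m: "m > 0" using less[OF z0(1)] by (simp add: m_def)
  obtain d where d: "d > 0" "\<And>z z'. z \<in> Q \<Longrightarrow> z' \<in> Q \<Longrightarrow> dist z' z < d \<Longrightarrow> dist (g z') (g z) < m"
    using compact_uniformly_continuous[OF g Q] m unfolding uniformly_continuous_on_def by metis
  obtain z z' where z: "z \<in> Q" "z' \<in> Q" "dist z z' \<le> min m (d / 2)" "f z \<le> g z' + min m (d / 2)"
    using near[of "min m (d / 2)"] m d(1) by auto
  have "\<bar>g z' - g z\<bar> < m"
    using d(2)[OF z(1,2)] z(3) d(1) by (simp add: dist_commute dist_real_def)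
  moreover have "2 * m \<le> f z - g z" using bspec[OF z0(2) z(1)] by (simp add: m_def)
  ultimately show False using z(4) by (simp add: min_def abs_less_iff split: if_splits)
qed

lemma jet_doubling_near_pair:
  fixes u :: "'a::euclidean_space \<Rightarrow> real"
  assumes r: "r > 0" and \<epsilon>: "\<epsilon> > 0" "24 * L * \<epsilon> < r" and lip: "L-lipschitz_on (cball x0 r) u"
    and lip_\<beta>: "K-lipschitz_on (cball x0 r \<times> cball 0 (6 * L)) \<beta>"
    and N: "\<And>z. z \<in> cball x0 r \<times> cball 0 (6 * L) \<Longrightarrow> norm (\<beta> z) \<le> N"
    and \<beta>: "continuous_on (cball x0 r \<times> UNIV) \<beta>"
    and \<gamma>: "continuous_on (cball x0 r \<times> UNIV) \<gamma>" and \<gamma>': "continuous_on (cball x0 r \<times> UNIV) \<gamma>'"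
    and sub: "jet_subsolution (ball x0 r) \<beta> \<gamma> u" and super: "jet_supersolution (ball x0 r) \<beta> \<gamma>' u"
    and \<kappa>: "\<kappa> > 0" "\<kappa> * r\<^sup>2 = 24 * L\<^sup>2 + 1"
  shows "\<exists>z\<in>cball x0 r \<times> cball 0 (6 * L). \<exists>z'\<in>cball x0 r \<times> cball 0 (6 * L).
    dist z z' \<le> (6 * L + 2 * \<kappa> * r) * \<epsilon> \<and>
    \<gamma> z \<le> \<gamma>' z' + ((K * (6 * L + 2 * \<kappa> * r))\<^sup>2 + 2 * \<kappa> * N\<^sup>2) * \<epsilon>"
proof -
  have \<mu>: "\<kappa> * \<epsilon> \<ge> 0" using \<kappa>(1) \<epsilon>(1) by simp
  have "\<kappa> * \<epsilon> * r\<^sup>2 = (24 * L\<^sup>2 + 1) * \<epsilon>" unfolding \<kappa>(2)[symmetric] by simp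
  then have small: "24 * L\<^sup>2 * \<epsilon> < \<kappa> * \<epsilon> * r\<^sup>2" using \<epsilon>(1) by (simp add: distrib_right)
  have flip: "continuous_on (ball x0 r \<times> UNIV) (\<lambda>(x, p). F (x, - p))"
    if "continuous_on (cball x0 r \<times> UNIV) F" for F :: "'a \<times> 'a \<Rightarrow> 'b::topological_space"
    unfolding split_beta by (rule continuous_on_compose2[OF that]) (auto intro!: continuous_intros)
  have on_ball: "continuous_on (ball x0 r \<times> UNIV) F"
    if "continuous_on (cball x0 r \<times> UNIV) F" for F :: "'a \<times> 'a \<Rightarrow> 'b::topological_space"
    by (rule continuous_on_subset[OF that]) auto
  obtain x y p q where xy: "x \<in> cball x0 r" "y \<in> cball x0 r" "norm (x - y) \<le> 6 * L * \<epsilon>"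
    and pq: "norm p \<le> 6 * L" "norm q \<le> 6 * L" "norm (p + q) \<le> 2 * (\<kappa> * \<epsilon>) * r"
    and ineq: "\<gamma> (x, p) - \<gamma>' (y, - q)
      \<le> (norm (\<beta> (x, p) - \<beta> (y, - q)))\<^sup>2 / \<epsilon> + 2 * (\<kappa> * \<epsilon>) * (norm (\<beta> (x, p)))\<^sup>2"
    by (rule doubling_inequality[OF \<epsilon>(1) \<mu> r lip on_ball[OF \<beta>] on_ball[OF \<gamma>] flip[OF \<beta>]
          flip[OF continuous_on_minus[OF \<gamma>']] sub super[unfolded jet_supersolution_def] \<epsilon>(2) small])
      (rule that; simp)
  define D where "D = 6 * L + 2 * \<kappa> * r"
  let ?z = "(x, p)" and ?z' = "(y, - q)"
  have Q: "?z \<in> cball x0 r \<times> cball 0 (6 * L)" "?z' \<in> cball x0 r \<times> cball 0 (6 * L)"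
    using xy pq by auto
  have "dist ?z ?z' \<le> norm (x - y) + norm (p + q)"
    using norm_Pair_le[of "x - y" "p + q"] by (simp add: dist_norm)
  also have "\<dots> \<le> D * \<epsilon>" using xy(3) pq(3) by (simp add: D_def algebra_simps)
  finally have near: "dist ?z ?z' \<le> D * \<epsilon>" .
  have "norm (\<beta> ?z - \<beta> ?z') \<le> K * (D * \<epsilon>)"
    using lipschitz_onD[OF lip_\<beta> Q] mult_left_mono[OF near lipschitz_on_nonneg[OF lip_\<beta>]]
    by (simp add: dist_norm)
  then have "(norm (\<beta> ?z - \<beta> ?z'))\<^sup>2 \<le> (K * (D * \<epsilon>))\<^sup>2" by (intro power_mono) auto
  then have "(norm (\<beta> ?z - \<beta> ?z'))\<^sup>2 / \<epsilon> \<le> (K * D)\<^sup>2 * \<epsilon>"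
    using \<epsilon>(1) by (simp add: pos_divide_le_eq power2_eq_square mult_ac)
  moreover have "2 * (\<kappa> * \<epsilon>) * (norm (\<beta> ?z))\<^sup>2 \<le> 2 * (\<kappa> * \<epsilon>) * N\<^sup>2"
    using N[OF Q(1)] \<mu> by (intro mult_left_mono power_mono) auto
  ultimately have "\<gamma> ?z \<le> \<gamma>' ?z' + ((K * D)\<^sup>2 + 2 * \<kappa> * N\<^sup>2) * \<epsilon>"
    using ineq by (simp add: algebra_simps)
  then show ?thesis
    using Q near unfolding D_def by blast
qed

lemma jet_comparison_on_cball:
  fixes u :: "'a::euclidean_space \<Rightarrow> real"
  assumes r: "r > 0" and lip: "L-lipschitz_on (cball x0 r) u"
    and lip_\<beta>: "K-lipschitz_on (cball x0 r \<times> cball 0 (6 * L)) \<beta>"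
    and \<beta>: "continuous_on (cball x0 r \<times> UNIV) \<beta>"
    and \<gamma>: "continuous_on (cball x0 r \<times> UNIV) \<gamma>" and \<gamma>': "continuous_on (cball x0 r \<times> UNIV) \<gamma>'"
    and sub: "jet_subsolution (ball x0 r) \<beta> \<gamma> u" and super: "jet_supersolution (ball x0 r) \<beta> \<gamma>' u"
  shows "\<exists>x\<in>cball x0 r. \<exists>p. \<gamma> (x, p) \<le> \<gamma>' (x, p)"
proof -
  let ?Q = "cball x0 r \<times> cball (0 :: 'a) (6 * L)"
  have Q: "compact ?Q" by (intro compact_Times compact_cball)
  have L: "L \<ge> 0" using lip by (rule lipschitz_on_nonneg)
  have "bounded (\<beta> ` ?Q)"
    by (intro compact_imp_bounded compact_continuous_image lipschitz_on_continuous_on[OF lip_\<beta>] Q)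
  then obtain N where N: "\<And>z. z \<in> ?Q \<Longrightarrow> norm (\<beta> z) \<le> N"
    unfolding bounded_iff by blast
  define \<kappa> where "\<kappa> = (24 * L\<^sup>2 + 1) / r\<^sup>2"
  have \<kappa>: "\<kappa> > 0" "\<kappa> * r\<^sup>2 = 24 * L\<^sup>2 + 1" using r by (auto simp: \<kappa>_def add_nonneg_pos)
  define D where "D = 6 * L + 2 * \<kappa> * r"
  define M where "M = (K * D)\<^sup>2 + 2 * \<kappa> * N\<^sup>2"
  have D: "D \<ge> 0" and M: "M \<ge> 0" using L \<kappa>(1) r by (auto simp: D_def M_def)
  note near_pair = jet_doubling_near_pair[OF r _ _ lip lip_\<beta> N \<beta> \<gamma> \<gamma>' sub super \<kappa>, folded D_def, folded M_def]
  have "\<exists>z\<in>?Q. \<exists>z'\<in>?Q. dist z z' \<le> \<delta> \<and> \<gamma> z \<le> \<gamma>' z' + \<delta>" if \<delta>: "\<delta> > 0" for \<delta>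
  proof -
    define \<epsilon> where "\<epsilon> = min \<delta> r / (1 + 24 * L + D + M)"
    have "1 + 24 * L + D + M > 0" using L D M by linarith
    then have \<epsilon>: "\<epsilon> > 0" "(1 + 24 * L + D + M) * \<epsilon> = min \<delta> r" using \<delta> r by (auto simp: \<epsilon>_def)
    then have "\<epsilon> + 24 * L * \<epsilon> + D * \<epsilon> + M * \<epsilon> = min \<delta> r" by (simp add: algebra_simps)
    moreover have "0 \<le> L * \<epsilon>" "0 \<le> D * \<epsilon>" "0 \<le> M * \<epsilon>" using L D M \<epsilon>(1) by auto
    ultimately have "24 * L * \<epsilon> < r" "D * \<epsilon> \<le> \<delta>" "M * \<epsilon> \<le> \<delta>" using \<epsilon>(1) by auto
    with near_pair[OF \<epsilon>(1)] show ?thesis by (meson add_left_mono order_trans)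
  qed
  then have "\<exists>z\<in>?Q. \<gamma> z \<le> \<gamma>' z"
    by (intro compact_near_diagonal_le Q continuous_on_subset[OF \<gamma>] continuous_on_subset[OF \<gamma>']) auto
  then show ?thesis by auto
qed

section \<open>Smooth bump functions\<close>

text \<open>The factors \<open>inverse t ^ m\<close> make this family closed under differentiation up to linear combinations.\<close>

definition flat :: "nat \<Rightarrow> real \<Rightarrow> real" where
  "flat m t = (if t > 0 then exp (- inverse t) * inverse t ^ m else 0)"

lemma flat_nonneg: "flat m t \<ge> 0"
  by (simp add: flat_def)

lemma flat_le_square: "flat m t \<le> real (m + 2) ^ (m + 2) * t\<^sup>2"
proof (cases "t > 0")
  case True
  define n where "n = m + 2"
  have n: "n > 0" by (simp add: n_def)
  have "(inverse t / real n) ^ n \<le> (1 + inverse t / real n) ^ n"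
    using True by (intro power_mono) auto
  also have "\<dots> \<le> exp (inverse t)"
    using exp_ge_one_plus_x_over_n_power_n[of n "inverse t"] True n by (simp add: order_trans[of _ 0])
  finally have "exp (- inverse t) \<le> inverse ((inverse t / real n) ^ n)"
    unfolding exp_minus using True n by (intro le_imp_inverse_le) auto
  also have "\<dots> = real n ^ n * t ^ n"
    using True
    by (simp add: power_inverse[symmetric] power_mult_distrib[symmetric] divide_inverse mult.commute)
  finally have "flat m t \<le> real n ^ n * (t ^ n * inverse t ^ m)"
    using True by (simp add: flat_def)
  also have "t ^ n * inverse t ^ m = t\<^sup>2"
    using True by (simp add: n_def power_add power_inverse power2_eq_square field_simps)
  finally show ?thesis by (simp add: n_def)
qed (simp add: flat_def)

lemma DERIV_flat_at_0: "DERIV (flat m) 0 :> 0"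
proof -
  let ?C = "real (m + 2) ^ (m + 2)"
  have "((\<lambda>t. (flat m t - flat m 0) / (t - 0)) \<longlongrightarrow> 0) (at 0)"
  proof (rule Lim_null_comparison)
    have "norm ((flat m t - flat m 0) / (t - 0)) \<le> ?C * \<bar>t\<bar>" for t
    proof -
      have "\<bar>flat m t\<bar> \<le> ?C * (\<bar>t\<bar> * \<bar>t\<bar>)"
        using flat_le_square[of m t] flat_nonneg[of m t] by (simp add: power2_eq_square)
      then show ?thesis
        by (cases "t = 0") (simp_all add: flat_def[of m 0] field_simps)
    qed
    then show "\<forall>\<^sub>F t in at 0. norm ((flat m t - flat m 0) / (t - 0)) \<le> ?C * \<bar>t\<bar>"
      by (simp add: always_eventually)
    show "((\<lambda>t. ?C * \<bar>t\<bar>) \<longlongrightarrow> 0) (at 0)"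
      by (auto intro!: tendsto_eq_intros)
  qed
  then show ?thesis
    by (simp add: has_field_derivative_iff)
qed

lemma DERIV_flat: "DERIV (flat m) t :> flat (m + 2) t - real m * flat (m + 1) t"
proof -
  consider (pos) "t > 0" | (neg) "t < 0" | (zero) "t = 0" by linarith
  then show ?thesis
  proof cases
    case pos
    have mult_power_pred: "x * x ^ (k - Suc 0) = (if k = 0 then x else x ^ k)" for x :: real and k
      by (cases k) auto
    have "((\<lambda>t. exp (- inverse t) * inverse t ^ m) has_field_derivative
        flat (m + 2) t - real m * flat (m + 1) t) (at t)"
      using pos by (cases m)
        (auto intro!: derivative_eq_intros simp: flat_def power2_eq_square algebra_simps mult_power_pred)
    then show ?thesis
      by (rule has_field_derivative_transform_within_open[where S = "{0<..}"])
        (use pos in \<open>auto simp: flat_def\<close>)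
  next
    case neg
    have "((\<lambda>t. 0) has_field_derivative flat (m + 2) t - real m * flat (m + 1) t) (at t)"
      using neg by (auto simp: flat_def)
    then show ?thesis
      by (rule has_field_derivative_transform_within_open[where S = "{..<0}"])
        (use neg in \<open>auto simp: flat_def\<close>)
  next
    case zero
    then show ?thesis
      using DERIV_flat_at_0 by (simp add: flat_def[of _ 0])
  qed
qed

lemma continuous_on_flat [continuous_intros]:
  "continuous_on S f \<Longrightarrow> continuous_on S (\<lambda>x. flat m (f x))"
  by (rule continuous_on_compose2[of UNIV "flat m"])
    (auto intro!: continuous_at_imp_continuous_on DERIV_isCont DERIV_flat)


definition bump :: "nat \<Rightarrow> real \<Rightarrow> real^'n \<Rightarrow> real^'n \<Rightarrow> real" where
  "bump m \<delta> z x = flat m (\<delta>\<^sup>2 - (x - z) \<bullet> (x - z))"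

lemma has_derivative_bump:
  "(bump m \<delta> z has_derivative
     (\<lambda>h. (bump (m + 2) \<delta> z x - real m * bump (m + 1) \<delta> z x) * (- 2 * ((x - z) \<bullet> h)))) (at x)"
proof -
  have inner_deriv: "((\<lambda>x. \<delta>\<^sup>2 - (x - z) \<bullet> (x - z)) has_derivative (\<lambda>h. - 2 * ((x - z) \<bullet> h))) (at x)"
    by (auto intro!: derivative_eq_intros simp: fun_eq_iff inner_commute)
  show ?thesis
    using has_derivative_compose[OF inner_deriv DERIV_flat[unfolded has_field_derivative_def], of m]
    unfolding bump_def[abs_def] .
qed

lemma continuous_on_bump [continuous_intros]:
  "continuous_on S f \<Longrightarrow> continuous_on S g \<Longrightarrow> continuous_on S (\<lambda>x. bump m \<delta> (f x) (g x))"
  unfolding bump_def by (intro continuous_intros)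

lemma pderiv_i_bump:
  "pderiv_i (bump m \<delta> z) i =
    (\<lambda>x. (bump (m + 2) \<delta> z x + - real m * bump (m + 1) \<delta> z x) * (- 2 * x $ i + 2 * z $ i))"
  by (rule ext) (simp add: pderiv_i_eqI[OF has_derivative_bump] inner_axis)

lemma Ck_on_bump: "Ck_on k UNIV (bump m \<delta> z)"
proof (induction k arbitrary: m)
  case (Suc k)
  have "bounded_linear (\<lambda>x :: real^'a. - 2 * x $ i)" for i
    by (rule bounded_linear_compose[OF bounded_linear_mult_right bounded_linear_vec_nth])
  then have "Ck_on k UNIV (pderiv_i (bump m \<delta> z) i)" for i
    unfolding pderiv_i_bump by (intro Ck_on_add Ck_on_mult Ck_on_const Ck_on_affine Suc.IH open_UNIV)
  moreover have "bump m \<delta> z differentiable at x" for x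
    using has_derivative_bump unfolding differentiable_def by blast
  ultimately show ?case by (auto intro!: continuous_intros)
qed (auto intro!: continuous_intros)

lemma bump_nonneg: "bump m \<delta> z x \<ge> 0"
  by (simp add: bump_def flat_nonneg)

lemma bump_eq_0:
  assumes "\<delta> \<ge> 0" "x \<notin> cball z \<delta>"
  shows "bump m \<delta> z x = 0"
proof -
  have "\<delta>\<^sup>2 \<le> (norm (x - z))\<^sup>2"
    using assms by (intro power_mono) (auto simp: dist_norm norm_minus_commute)
  then show ?thesis by (simp add: bump_def flat_def power2_norm_eq_inner)
qed

lemma test_fun_bump:
  assumes "\<delta> \<ge> 0" "cball z \<delta> \<subseteq> \<Omega>"
  shows "test_fun \<Omega> (bump m \<delta> z)"
proof -
  have support: "{x. bump m \<delta> z x \<noteq> 0} \<subseteq> cball z \<delta>"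
    using bump_eq_0[OF assms(1)] by blast
  then have "closure {x. bump m \<delta> z x \<noteq> 0} \<subseteq> cball z \<delta>"
    by (intro closure_minimal closed_cball)
  moreover have "compact (closure {x. bump m \<delta> z x \<noteq> 0})"
    using bounded_subset[OF bounded_cball support] by simp
  ultimately show ?thesis
    using assms Ck_on_bump by (auto simp: test_fun_def smooth_on_def)
qed

lemma integral_bump:
  fixes z :: "real^'n"
  assumes "\<delta> \<ge> 0" "cball z \<delta> \<subseteq> cbox a b"
  shows "integral (cbox a b) (bump m \<delta> z) = integral UNIV (bump m \<delta> (0 :: real^'n))"
proof -
  have shift: "bump m \<delta> z \<circ> (+) z = bump m \<delta> 0"
    by (simp add: fun_eq_iff bump_def)
  have sub: "cball 0 \<delta> \<subseteq> cbox (a - z) (b - z)"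
  proof
    fix x :: "real^'n" assume "x \<in> cball 0 \<delta>"
    then have "x + z \<in> cball z \<delta>" by (simp add: dist_norm)
    then have "x + z \<in> cbox a b" using assms(2) by blast
    then show "x \<in> cbox (a - z) (b - z)" by (auto simp: mem_box inner_simps)
  qed
  have zero: "bump m \<delta> 0 x = 0" if "x \<notin> cbox (a - z) (b - z)" for x
    using that sub by (intro bump_eq_0[OF assms(1)]) blast
  have "integral (cbox a b) (bump m \<delta> z) = integral (cbox (a - z) (b - z)) (bump m \<delta> 0)"
    using integral_shift_cbox_plus[of "a - z" "b - z" "bump m \<delta> z" z] by (simp add: shift)
  also have "\<dots> = integral UNIV (\<lambda>x. if x \<in> cbox (a - z) (b - z) then bump m \<delta> 0 x else 0)"
    by (simp only: integral_restrict_UNIV)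
  also have "(\<lambda>x. if x \<in> cbox (a - z) (b - z) then bump m \<delta> 0 x else 0) = bump m \<delta> 0"
    using zero by auto
  finally show ?thesis .
qed

lemma integral_bump_pos:
  assumes "\<delta> > 0"
  shows "integral UNIV (bump m \<delta> (0 :: real^'n)) > 0"
proof -
  obtain a :: "real^'n" where a: "cball 0 \<delta> \<subseteq> box (- a) a"
    using bounded_subset_box_symmetric[OF bounded_cball] by blast
  define b where "b = - a"
  have zero: "0 \<in> box b a" using a assms by (auto simp: b_def)
  have int: "bump m \<delta> 0 integrable_on cbox b a"
    by (intro integrable_continuous continuous_intros)
  have "integral (cbox b a) (bump m \<delta> 0) \<noteq> 0"
  proof
    assume "integral (cbox b a) (bump m \<delta> 0) = 0"
    then have "(bump m \<delta> 0 has_integral 0) (cbox b a)"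
      using integrable_integral[OF int] by simp
    then have "bump m \<delta> 0 (0 :: real^'n) = 0"
      using zero box_subset_cbox[of b a]
      by (intro has_integral_0_cbox_imp_0[of b a "bump m \<delta> 0"] bump_nonneg continuous_intros) auto
    then show False using assms by (simp add: bump_def flat_def)
  qed
  moreover have "integral (cbox b a) (bump m \<delta> 0) \<ge> 0"
    by (intro integral_nonneg int bump_nonneg)
  moreover have "cball 0 \<delta> \<subseteq> cbox b a"
    using a box_subset_cbox[of b a] by (simp add: b_def)
  ultimately show ?thesis
    using integral_bump[of \<delta> 0 b a m] assms by simp
qed

section \<open>Local Lipschitz continuity of Sobolev functions\<close>

definition weak_gradient :: "(real^'n) set \<Rightarrow> (real^'n \<Rightarrow> real) \<Rightarrow> (real^'n \<Rightarrow> real^'n) \<Rightarrow> bool" where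
  "weak_gradient \<Omega> u G \<longleftrightarrow> (\<forall>\<phi> i. test_fun \<Omega> \<phi> \<longrightarrow>
    (LINT x:\<Omega>|lebesgue. u x * pderiv_i \<phi> i x) = - (LINT x:\<Omega>|lebesgue. G x $ i * \<phi> x))"

definition mollify :: "real \<Rightarrow> (real^'n) set \<Rightarrow> (real^'n \<Rightarrow> real) \<Rightarrow> real^'n \<Rightarrow> real" where
  "mollify \<delta> S u z = integral S (\<lambda>x. u x * bump 0 \<delta> z x) / integral UNIV (bump 0 \<delta> (0 :: real^'n))"

lemma mollify_diff_le:
  fixes u :: "real^'n \<Rightarrow> real"
  assumes \<delta>: "\<delta> > 0" and z: "cball z \<delta> \<subseteq> cbox a b" and u: "continuous_on (cbox a b) u"
    and osc: "\<And>x. x \<in> cball z \<delta> \<Longrightarrow> \<bar>u x - u z\<bar> \<le> \<omega>"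
  shows "\<bar>mollify \<delta> (cbox a b) u z - u z\<bar> \<le> \<omega>"
proof -
  let ?c = "integral UNIV (bump 0 \<delta> (0 :: real^'n))"
  have c: "integral (cbox a b) (bump 0 \<delta> z) = ?c" "?c > 0"
    using integral_bump[OF _ z] integral_bump_pos[OF \<delta>] \<delta> by auto
  have "(mollify \<delta> (cbox a b) u z - u z) * ?c = integral (cbox a b) (\<lambda>x. u x * bump 0 \<delta> z x) - u z * ?c"
    using c(2) by (simp add: mollify_def left_diff_distrib)
  also have "\<dots> = integral (cbox a b) (\<lambda>x. u x * bump 0 \<delta> z x - u z * bump 0 \<delta> z x)"
    unfolding c(1)[symmetric]
    by (subst integral_diff) (auto intro!: integrable_continuous continuous_intros u)
  also have "\<bar>\<dots>\<bar> \<le> integral (cbox a b) (\<lambda>x. \<omega> * bump 0 \<delta> z x)"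
    unfolding real_norm_def[symmetric]
  proof (rule integral_norm_bound_integral)
    fix x assume "x \<in> cbox a b"
    have "\<bar>u x - u z\<bar> * bump 0 \<delta> z x \<le> \<omega> * bump 0 \<delta> z x"
      using osc[of x] bump_eq_0[of \<delta> x z 0] \<delta>
      by (cases "x \<in> cball z \<delta>") (auto intro: mult_right_mono bump_nonneg)
    then show "norm (u x * bump 0 \<delta> z x - u z * bump 0 \<delta> z x) \<le> \<omega> * bump 0 \<delta> z x"
      by (simp add: left_diff_distrib[symmetric] abs_mult bump_nonneg)
  qed (auto intro!: integrable_continuous continuous_intros u)
  also have "\<dots> = \<omega> * ?c" by (simp add: c(1))
  finally show ?thesis
    using c(2) by (simp add: abs_mult)
qed

definition bump_center_deriv :: "real \<Rightarrow> real^'n \<Rightarrow> real^'n \<Rightarrow> (real^'n) \<Rightarrow>\<^sub>L real" where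
  "bump_center_deriv \<delta> z x = (2 * bump 2 \<delta> z x) *\<^sub>R blinfun_inner_left (x - z)"

lemma has_derivative_bump_center:
  "((\<lambda>z. bump 0 \<delta> z x) has_derivative blinfun_apply (bump_center_deriv \<delta> z x)) (at z)"
proof -
  have "((\<lambda>z. x - z) has_derivative (\<lambda>h. - h)) (at z)"
    by (auto intro!: derivative_eq_intros)
  from has_derivative_compose[OF this has_derivative_bump[of 0 \<delta> 0]]
  have "((\<lambda>z. bump 0 \<delta> z x) has_derivative (\<lambda>h. bump 2 \<delta> z x * (2 * ((x - z) \<bullet> h)))) (at z)"
    by (simp add: bump_def numeral_2_eq_2)
  moreover have "blinfun_apply (bump_center_deriv \<delta> z x) = (\<lambda>h. bump 2 \<delta> z x * (2 * ((x - z) \<bullet> h)))"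
    by (simp add: fun_eq_iff bump_center_deriv_def blinfun.scaleR_left inner_commute)
  ultimately show ?thesis by simp
qed

lemma bump_center_deriv_eq_sum:
  "bump_center_deriv \<delta> z x h = (\<Sum>i\<in>UNIV. - (h $ i) * pderiv_i (bump 0 \<delta> z) i x)"
  by (auto simp: bump_center_deriv_def blinfun.scaleR_left pderiv_i_bump inner_vec_def sum_distrib_left
      numeral_2_eq_2 algebra_simps intro!: sum.cong)

lemma continuous_on_bump_center_deriv [continuous_intros]:
  "continuous_on S f \<Longrightarrow> continuous_on S g \<Longrightarrow> continuous_on S (\<lambda>w. bump_center_deriv \<delta> (f w) (g w))"
  unfolding bump_center_deriv_def
  by (intro continuous_intros bounded_linear.continuous_on[OF bounded_linear_blinfun_inner_left])

lemma has_derivative_mollify: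
  fixes u :: "real^'n \<Rightarrow> real"
  assumes u: "continuous_on (cbox a b) u"
  shows "(mollify \<delta> (cbox a b) u has_derivative
    (\<lambda>h. - (\<Sum>i\<in>UNIV. h $ i * integral (cbox a b) (\<lambda>x. u x * pderiv_i (bump 0 \<delta> z) i x))
      / integral UNIV (bump 0 \<delta> (0 :: real^'n)))) (at z)"
proof -
  let ?D = "\<lambda>z x. u x *\<^sub>R bump_center_deriv \<delta> z x"
  have "((\<lambda>z. integral (cbox a b) (\<lambda>x. u x * bump 0 \<delta> z x)) has_derivative
      integral (cbox a b) (?D z)) (at z within UNIV)"
  proof (rule leibniz_rule)
    show "((\<lambda>z. u x * bump 0 \<delta> z x) has_derivative blinfun_apply (?D z x)) (at z within UNIV)" for z x
      using has_derivative_mult_right[OF has_derivative_bump_center]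
      by (simp add: blinfun.scaleR_left[abs_def])
    show "(\<lambda>x. u x * bump 0 \<delta> z x) integrable_on cbox a b" for z
      by (intro integrable_continuous continuous_intros u)
    have "continuous_on (UNIV \<times> cbox a b) (\<lambda>p. u (snd p))"
      by (rule continuous_on_compose2[OF u]) (auto intro!: continuous_intros)
    then show "continuous_on (UNIV \<times> cbox a b) (\<lambda>(z, x). ?D z x)"
      unfolding split_beta by (intro continuous_intros)
  qed auto
  moreover have "blinfun_apply (integral (cbox a b) (?D z)) h =
      - (\<Sum>i\<in>UNIV. h $ i * integral (cbox a b) (\<lambda>x. u x * pderiv_i (bump 0 \<delta> z) i x))" for h
  proof -
    have "?D z integrable_on cbox a b"
      by (intro integrable_continuous continuous_intros u)
    then have "blinfun_apply (integral (cbox a b) (?D z)) h = integral (cbox a b) (\<lambda>x. ?D z x h)"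
      by (rule blinfun_apply_integral)
    also have "(\<lambda>x. ?D z x h) = (\<lambda>x. \<Sum>i\<in>UNIV. - (h $ i) * (u x * pderiv_i (bump 0 \<delta> z) i x))"
      by (simp add: fun_eq_iff blinfun.scaleR_left bump_center_deriv_eq_sum sum_distrib_left mult_ac)
    also have "integral (cbox a b) \<dots> =
        (\<Sum>i\<in>UNIV. - (h $ i) * integral (cbox a b) (\<lambda>x. u x * pderiv_i (bump 0 \<delta> z) i x))"
      by (subst integral_sum) (auto simp: pderiv_i_bump intro!: integrable_continuous continuous_intros u)
    finally show ?thesis by (simp add: sum_negf)
  qed
  ultimately show ?thesis
    unfolding mollify_def divide_inverse by (auto intro!: derivative_eq_intros simp: fun_eq_iff)
qed

lemma abs_set_lebesgue_integral_mult_le: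
  fixes g \<phi> :: "'a \<Rightarrow> real"
  assumes \<phi>: "set_integrable M A \<phi>" "\<And>x. \<phi> x \<ge> 0" and C: "C \<ge> 0"
    and bound: "AE x in M. \<phi> x \<noteq> 0 \<longrightarrow> \<bar>g x\<bar> \<le> C"
  shows "\<bar>LINT x:A|M. g x * \<phi> x\<bar> \<le> C * (LINT x:A|M. \<phi> x)"
proof -
  let ?F = "\<lambda>x. indicator A x *\<^sub>R (g x * \<phi> x)" and ?H = "\<lambda>x. C * (indicator A x *\<^sub>R \<phi> x)"
  have int: "integrable M ?H"
    using \<phi>(1) unfolding set_integrable_def by (rule integrable_mult_right)
  have "AE x in M. \<bar>?F x\<bar> \<le> ?H x"
    using bound
  proof eventually_elim
    case (elim x)
    then have "\<bar>g x\<bar> * \<phi> x \<le> C * \<phi> x"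
      using \<phi>(2)[of x] by (cases "\<phi> x = 0") (auto intro: mult_right_mono)
    then show ?case using \<phi>(2)[of x] by (simp add: indicator_def abs_mult)
  qed
  then have le: "AE x in M. ?F x \<le> ?H x" "AE x in M. - ?F x \<le> ?H x"
    by (eventually_elim, linarith)+
  have nonneg: "AE x in M. 0 \<le> ?H x"
    using C \<phi>(2) by simp
  show ?thesis
    using integral_mono_AE'[OF int le(1) nonneg] integral_mono_AE'[OF int le(2) nonneg]
    by (simp add: set_lebesgue_integral_def abs_le_iff)
qed

lemma set_lebesgue_integral_eq_integral_cbox:
  fixes w :: "'a::euclidean_space \<Rightarrow> real"
  assumes "cbox a b \<subseteq> \<Omega>" "continuous_on (cbox a b) w" "\<And>x. x \<notin> cbox a b \<Longrightarrow> w x = 0"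
  shows "set_integrable lebesgue \<Omega> w" "(LINT x:\<Omega>|lebesgue. w x) = integral (cbox a b) w"
proof -
  have "w absolutely_integrable_on cbox a b"
    by (intro absolutely_integrable_continuous assms)
  moreover have "(\<lambda>x. indicator \<Omega> x *\<^sub>R w x) = (\<lambda>x. indicator (cbox a b) x *\<^sub>R w x)"
    using assms(1,3) by (auto simp: fun_eq_iff indicator_def)
  ultimately show "set_integrable lebesgue \<Omega> w" "(LINT x:\<Omega>|lebesgue. w x) = integral (cbox a b) w"
    using set_lebesgue_integral_eq_integral(2)[of "cbox a b" w]
    by (simp_all add: set_integrable_def set_lebesgue_integral_def)
qed

lemma abs_integral_mult_pderiv_i_bump_le:
  fixes u :: "real^'n \<Rightarrow> real"
  assumes G: "weak_gradient \<Omega> u G" and ab: "cbox a b \<subseteq> \<Omega>" and u: "continuous_on (cbox a b) u"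
    and M: "AE x in lebesgue. x \<in> cbox a b \<longrightarrow> norm (G x) \<le> M" "M \<ge> 0"
    and \<delta>: "\<delta> \<ge> 0" and z: "cball z \<delta> \<subseteq> cbox a b"
  shows "\<bar>integral (cbox a b) (\<lambda>x. u x * pderiv_i (bump 0 \<delta> z) i x)\<bar>
    \<le> M * integral UNIV (bump 0 \<delta> (0 :: real^'n))"
proof -
  have zero: "bump m \<delta> z x = 0" if "x \<notin> cbox a b" for x m
    using that z by (intro bump_eq_0[OF \<delta>]) auto
  have "integral (cbox a b) (\<lambda>x. u x * pderiv_i (bump 0 \<delta> z) i x) =
      (LINT x:\<Omega>|lebesgue. u x * pderiv_i (bump 0 \<delta> z) i x)"
    by (rule set_lebesgue_integral_eq_integral_cbox(2)[OF ab, symmetric])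
      (auto simp: pderiv_i_bump zero intro!: continuous_intros u)
  also have "\<dots> = - (LINT x:\<Omega>|lebesgue. G x $ i * bump 0 \<delta> z x)"
    using G test_fun_bump[OF \<delta>, of z \<Omega> 0] z ab by (auto simp: weak_gradient_def)
  also have "\<bar>\<dots>\<bar> \<le> M * (LINT x:\<Omega>|lebesgue. bump 0 \<delta> z x)"
    unfolding abs_minus_cancel
  proof (rule abs_set_lebesgue_integral_mult_le[OF _ bump_nonneg M(2)])
    show "set_integrable lebesgue \<Omega> (bump 0 \<delta> z)"
      by (rule set_lebesgue_integral_eq_integral_cbox(1)[OF ab _ zero]) (intro continuous_intros)
    show "AE x in lebesgue. bump 0 \<delta> z x \<noteq> 0 \<longrightarrow> \<bar>G x $ i\<bar> \<le> M"
      using M(1) by eventually_elim (use zero component_le_norm_cart order_trans in blast)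
  qed
  also have "(LINT x:\<Omega>|lebesgue. bump 0 \<delta> z x) = integral UNIV (bump 0 \<delta> (0 :: real^'n))"
    using set_lebesgue_integral_eq_integral_cbox(2)[OF ab _ zero] integral_bump[OF \<delta> z, of 0]
    by (simp add: continuous_on_bump)
  finally show ?thesis .
qed

lemma lipschitz_on_mollify:
  fixes u :: "real^'n \<Rightarrow> real"
  assumes G: "weak_gradient \<Omega> u G" and ab: "cbox a b \<subseteq> \<Omega>" and u: "continuous_on (cbox a b) u"
    and M: "AE x in lebesgue. x \<in> cbox a b \<longrightarrow> norm (G x) \<le> M" "M \<ge> 0"
    and \<delta>: "\<delta> > 0" and S: "convex S" "\<And>z. z \<in> S \<Longrightarrow> cball z \<delta> \<subseteq> cbox a b"
  shows "(real CARD('n) * M)-lipschitz_on S (mollify \<delta> (cbox a b) u)"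
proof (rule bounded_derivative_imp_lipschitz
    [OF has_derivative_mollify[OF u, THEN has_derivative_at_withinI] S(1)])
  let ?c = "integral UNIV (bump 0 \<delta> (0 :: real^'n))"
  fix z assume "z \<in> S"
  let ?J = "\<lambda>i. integral (cbox a b) (\<lambda>x. u x * pderiv_i (bump 0 \<delta> z) i x)"
  have J: "\<bar>?J i\<bar> \<le> M * ?c" for i
    using abs_integral_mult_pderiv_i_bump_le[OF G ab u M] \<delta> S(2)[OF \<open>z \<in> S\<close>] by simp
  have c: "?c > 0" by (rule integral_bump_pos[OF \<delta>])
  show "onorm (\<lambda>h. - (\<Sum>i\<in>UNIV. h $ i * ?J i) / ?c) \<le> real CARD('n) * M"
  proof (rule onorm_le)
    fix h :: "real^'n"
    have "norm (\<Sum>i\<in>UNIV. h $ i * ?J i) \<le> (\<Sum>i\<in>(UNIV :: 'n set). norm h * (M * ?c))"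
    proof (rule order_trans[OF norm_sum], rule sum_mono)
      show "norm (h $ i * ?J i) \<le> norm h * (M * ?c)" for i
        using component_le_norm_cart[of h i] J[of i] by (simp add: abs_mult mult_mono)
    qed
    then show "norm (- (\<Sum>i\<in>UNIV. h $ i * ?J i) / ?c) \<le> real CARD('n) * M * norm h"
      using c by (simp add: pos_divide_le_eq mult_ac)
  qed
qed (use M in simp)

lemma lipschitz_on_bounded_weak_gradient:
  fixes u :: "real^'n \<Rightarrow> real"
  assumes G: "weak_gradient \<Omega> u G" and ab: "cbox a b \<subseteq> \<Omega>" and u: "continuous_on (cbox a b) u"
    and M: "AE x in lebesgue. x \<in> cbox a b \<longrightarrow> norm (G x) \<le> M" "M \<ge> 0"
    and r: "r > 0" and S: "convex S" "\<And>z. z \<in> S \<Longrightarrow> cball z r \<subseteq> cbox a b"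
  shows "(real CARD('n) * M)-lipschitz_on S u"
proof (rule lipschitz_onI)
  fix y z assume yz: "y \<in> S" "z \<in> S"
  show "dist (u y) (u z) \<le> real CARD('n) * M * dist y z"
  proof (rule field_le_epsilon)
    fix \<omega> :: real assume \<omega>: "\<omega> > 0"
    obtain d where d: "d > 0"
        "\<And>x x'. x \<in> cbox a b \<Longrightarrow> x' \<in> cbox a b \<Longrightarrow> dist x' x < d \<Longrightarrow> dist (u x') (u x) < \<omega> / 2"
      using compact_uniformly_continuous[OF u compact_cbox] half_gt_zero[OF \<omega>]
      unfolding uniformly_continuous_on_def by metis
    define \<delta> where "\<delta> = min r (d / 2)"
    have \<delta>: "\<delta> > 0" "\<delta> \<le> r" "\<delta> < d" using r d(1) by (auto simp: \<delta>_def)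
    have sub: "cball x \<delta> \<subseteq> cbox a b" if "x \<in> S" for x
      using S(2)[OF that] \<delta>(2) by (meson subset_cball subset_trans)
    have near: "\<bar>mollify \<delta> (cbox a b) u x - u x\<bar> \<le> \<omega> / 2" if "x \<in> S" for x
    proof (rule mollify_diff_le[OF \<delta>(1) sub[OF that] u])
      fix x' assume x': "x' \<in> cball x \<delta>"
      then have "dist (u x') (u x) < \<omega> / 2"
        using sub[OF that] \<delta> by (intro d(2)) (auto simp: dist_commute)
      then show "\<bar>u x' - u x\<bar> \<le> \<omega> / 2" by (simp add: dist_real_def)
    qed
    have "dist (mollify \<delta> (cbox a b) u y) (mollify \<delta> (cbox a b) u z) \<le> real CARD('n) * M * dist y z"
      using lipschitz_on_mollify[OF G ab u M \<delta>(1) S(1) sub] yz by (rule lipschitz_onD)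
    then show "dist (u y) (u z) \<le> real CARD('n) * M * dist y z + \<omega>"
      using near[OF yz(1)] near[OF yz(2)] unfolding dist_real_def by linarith
  qed
qed (use M in simp)

lemma W1inf_loc_imp_lipschitz_on_cball:
  fixes u :: "real^'n \<Rightarrow> real"
  assumes \<Omega>: "open \<Omega>" and u: "W1inf_loc \<Omega> u" and x0: "x0 \<in> \<Omega>"
  obtains r L where "r > 0" "cball x0 r \<subseteq> \<Omega>" "L-lipschitz_on (cball x0 r) u"
proof -
  obtain a b where ab: "x0 \<in> box a b" "cbox a b \<subseteq> \<Omega>"
    using open_contains_cbox[of \<Omega> x0] \<Omega> x0 by metis
  obtain e where e: "e > 0" "cball x0 e \<subseteq> box a b"
    using open_contains_cball_eq[OF open_box] ab(1) by blast
  have cball: "cball z (e / 2) \<subseteq> cbox a b" if "z \<in> cball x0 (e / 2)" for z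
  proof -
    have "cball z (e / 2) \<subseteq> cball x0 e" using that by (simp add: cball_subset_cball_iff dist_commute)
    then show ?thesis using e(2) box_subset_cbox[of a b] by blast
  qed
  from u obtain G where G: "weak_gradient \<Omega> u G"
    and bound: "\<forall>K. compact K \<and> K \<subseteq> \<Omega> \<longrightarrow> (\<exists>M. AE x in lebesgue. x \<in> K \<longrightarrow> norm (G x) \<le> M)"
    unfolding W1inf_loc_def weak_gradient_def[symmetric] by (elim conjE exE) (rule that)
  obtain M where M: "AE x in lebesgue. x \<in> cbox a b \<longrightarrow> norm (G x) \<le> M"
    using bound[rule_format, of "cbox a b"] compact_cbox ab(2) by auto
  have "AE x in lebesgue. x \<in> cbox a b \<longrightarrow> norm (G x) \<le> max M 0"
    using M by eventually_elim auto
  moreover have "continuous_on (cbox a b) u"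
    using u ab(2) unfolding W1inf_loc_def by (blast intro: continuous_on_subset)
  ultimately have "(real CARD('n) * max M 0)-lipschitz_on (cball x0 (e / 2)) u"
    using e(1) by (intro lipschitz_on_bounded_weak_gradient[OF G ab(2) _ _ _ _ convex_cball cball]) auto
  moreover have "cball x0 (e / 2) \<subseteq> \<Omega>"
    using cball[of x0] e(1) ab(2) by auto
  ultimately show ?thesis using that[of "e / 2"] e(1) by simp
qed

section \<open>The comparison theorem\<close>

lemma C1_on_imp_continuous_on: "C1_on S F \<Longrightarrow> continuous_on S F"
  unfolding C1_on_def by (metis continuous_at_imp_continuous_on has_derivative_continuous)

lemma C1_on_imp_lipschitz_on:
  assumes F: "C1_on S F" and Q: "compact Q" "convex Q" "Q \<subseteq> S"
  shows "\<exists>K. K-lipschitz_on Q F"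
proof -
  obtain F' where F': "\<And>z. z \<in> S \<Longrightarrow> (F has_derivative blinfun_apply (F' z)) (at z)" "continuous_on S F'"
    using F unfolding C1_on_def by blast
  have "bounded (F' ` Q)"
    by (intro compact_imp_bounded compact_continuous_image continuous_on_subset[OF F'(2)] Q)
  then obtain K where K: "K > 0" "\<And>z. z \<in> Q \<Longrightarrow> norm (F' z) \<le> K"
    by (auto simp: bounded_pos)
  have "K-lipschitz_on Q F"
    using F'(1) K Q
    by (intro bounded_derivative_imp_lipschitz[of Q F "\<lambda>z. blinfun_apply (F' z)"])
      (auto simp: norm_blinfun.rep_eq[symmetric] intro: has_derivative_at_withinI)
  then show ?thesis ..
qed

lemma continuous_on_along_graph:
  assumes F: "continuous_on (\<Omega> \<times> UNIV \<times> UNIV) (\<lambda>(x, z, p). F x z p)"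
    and S: "S \<subseteq> \<Omega>" and u: "continuous_on S u"
  shows "continuous_on (S \<times> UNIV) (\<lambda>(x, p). F x (u x) p)"
proof -
  have "continuous_on (S \<times> UNIV) (\<lambda>w. u (fst w))"
    by (rule continuous_on_compose2[OF u]) (auto intro!: continuous_intros)
  then have "continuous_on (S \<times> UNIV) (\<lambda>w. (\<lambda>(x, z, p). F x z p) (fst w, u (fst w), snd w))"
    using S by (intro continuous_on_compose2[OF F] continuous_intros) auto
  then show ?thesis by (simp add: split_beta)
qed

lemma lipschitz_on_along_graph:
  fixes F :: "'a::euclidean_space \<Rightarrow> real \<Rightarrow> 'b::euclidean_space \<Rightarrow> 'c::euclidean_space"
  assumes F: "C1_on (\<Omega> \<times> UNIV \<times> UNIV) (\<lambda>(x, z, p). F x z p)"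
    and S: "compact S" "convex S" "S \<subseteq> \<Omega>" and u: "L-lipschitz_on S u"
  shows "\<exists>K. K-lipschitz_on (S \<times> cball 0 \<rho>) (\<lambda>(x, p). F x (u x) p)"
proof -
  let ?h = "\<lambda>w. (fst w, u (fst w), snd w)"
  let ?P = "S \<times> cball (0 :: 'b) \<rho>"
  let ?Q = "S \<times> (convex hull (u ` S)) \<times> cball (0 :: 'b) \<rho>"
  have "compact (convex hull (u ` S))"
    by (intro compact_convex_hull compact_continuous_image lipschitz_on_continuous_on[OF u] S)
  then have "compact ?Q" "convex ?Q"
    using S by (auto intro!: compact_Times convex_Times)
  then obtain K where K: "K-lipschitz_on ?Q (\<lambda>(x, z, p). F x z p)"
    using C1_on_imp_lipschitz_on[OF F, of ?Q] S(3) by blast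
  have fst: "1-lipschitz_on ?P fst" and snd: "1-lipschitz_on ?P snd"
    by (intro lipschitz_onI; simp add: dist_fst_le dist_snd_le)+
  have "L-lipschitz_on (fst ` ?P) u"
    using u by (rule lipschitz_on_subset) auto
  from lipschitz_on_Pair[OF fst lipschitz_on_Pair[OF lipschitz_on_compose2[OF fst this] snd]]
  obtain M where "M-lipschitz_on ?P ?h"
    by blast
  moreover have "?h ` ?P \<subseteq> ?Q"
    by (auto intro: hull_inc)
  ultimately have "(K * M)-lipschitz_on ?P (\<lambda>w. (\<lambda>(x, z, p). F x z p) (?h w))"
    using K by (intro lipschitz_on_compose2 lipschitz_on_subset[OF K])
  then show ?thesis by (auto simp: split_beta)
qed

lemma visc_comparison_on_cball:
  fixes u :: "real^'n \<Rightarrow> real"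
  assumes r: "r > 0" and sub: "cball x0 r \<subseteq> \<Omega>" and lip: "L-lipschitz_on (cball x0 r) u"
    and B: "C1_on (\<Omega> \<times> UNIV \<times> UNIV) (\<lambda>(x, z, p). B x z p)"
    and c: "continuous_on (\<Omega> \<times> UNIV \<times> UNIV) (\<lambda>(x, z, p). c x z p)"
    and f: "continuous_on \<Omega> f" and g: "continuous_on \<Omega> g"
    and visc: "visc_sub \<Omega> B c f u" "visc_super \<Omega> B c g u"
  shows "\<exists>x\<in>cball x0 r. f x \<le> g x"
proof -
  let ?\<beta> = "\<lambda>(x, p). B x (u x) p"
  note along_graph = continuous_on_along_graph[OF _ sub lipschitz_on_continuous_on[OF lip]]
  obtain K where K: "K-lipschitz_on (cball x0 r \<times> cball 0 (6 * L)) ?\<beta>"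
    using lipschitz_on_along_graph[OF B compact_cball convex_cball sub lip] by blast
  have cont: "continuous_on (cball x0 r \<times> UNIV) (\<lambda>(x, p). h x - c x (u x) p)" if "continuous_on \<Omega> h" for h
  proof -
    have "continuous_on (cball x0 r \<times> (UNIV :: (real^'n) set)) (\<lambda>w. h (fst w))"
      by (rule continuous_on_compose2[OF that]) (use sub in \<open>auto intro!: continuous_intros\<close>)
    then show ?thesis
      using continuous_on_diff[OF _ along_graph[OF c]] by (simp add: split_beta)
  qed
  have ball: "ball x0 r \<subseteq> \<Omega>" using sub by auto
  have "\<exists>x\<in>cball x0 r. \<exists>p. (\<lambda>(x, p). f x - c x (u x) p) (x, p) \<le> (\<lambda>(x, p). g x - c x (u x) p) (x, p)"
    using visc jet_subsolution_subset[OF visc_sub_imp_jet_subsolution open_ball ball]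
      jet_supersolution_subset[OF visc_super_imp_jet_supersolution open_ball ball]
    by (intro jet_comparison_on_cball
        [OF r lip K along_graph[OF C1_on_imp_continuous_on[OF B]] cont[OF f] cont[OF g]]) auto
  then show ?thesis by simp
qed

theorem theorem1p1:
  fixes \<Omega> :: "(real^'n) set"
    and B :: "real^'n \<Rightarrow> real \<Rightarrow> real^'n \<Rightarrow> real^'n"
    and c :: "real^'n \<Rightarrow> real \<Rightarrow> real^'n \<Rightarrow> real"
    and f g u :: "real^'n \<Rightarrow> real"
  assumes "open \<Omega>"
    and "C1_on (\<Omega> \<times> UNIV \<times> UNIV) (\<lambda>(x, z, p). B x z p)"
    and "continuous_on (\<Omega> \<times> UNIV \<times> UNIV) (\<lambda>(x, z, p). c x z p)"
    and "continuous_on \<Omega> f" and "continuous_on \<Omega> g"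
    and "W1inf_loc \<Omega> u"
    and "visc_sub \<Omega> B c f u"
    and "visc_super \<Omega> B c g u"
  shows "\<forall>x\<in>\<Omega>. f x \<le> g x"
proof (rule ballI, rule ccontr)
  fix x0 assume x0: "x0 \<in> \<Omega>" and "\<not> f x0 \<le> g x0"
  let ?W = "\<Omega> \<inter> (\<lambda>x. f x - g x) -` {0<..}"
  have "open ?W"
    by (rule continuous_open_preimage[OF continuous_on_diff[OF assms(4,5)] assms(1) open_greaterThan])
  moreover have "x0 \<in> ?W" using x0 \<open>\<not> f x0 \<le> g x0\<close> by simp
  ultimately obtain d where d: "d > 0" "cball x0 d \<subseteq> ?W"
    using open_contains_cball by blast
  obtain r0 L where r0: "r0 > 0" "L-lipschitz_on (cball x0 r0) u"
    using W1inf_loc_imp_lipschitz_on_cball[OF assms(1,6) x0] by blast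
  define r where "r = min r0 d"
  have r: "r > 0" "cball x0 r \<subseteq> ?W" and lip: "L-lipschitz_on (cball x0 r) u"
    using d r0 by (auto simp: r_def intro: lipschitz_on_subset)
  then have "cball x0 r \<subseteq> \<Omega>" by blast
  then obtain x where "x \<in> cball x0 r" "f x \<le> g x"
    using visc_comparison_on_cball[OF r(1) _ lip assms(2-5,7,8)] by blast
  then show False using r(2) by auto
qed

end
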